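(* The map $\mathtt{M}:(\mathfrak{A}^0,\star)\to\mathbb{R}$, $\mathtt{M}(w)=\int_0^1w$, is a homomorphism of $\mathbb{Q}$-algebras, where $\star$ is the stuffle product for alternating multiple mixed values defined in the context.
   Context: Put $\omega_0=\frac{dt}{t}$, $\omega_{+1}^{-1}=\frac{2\,dt}{1-t^2}$, $\omega_{-1}^{-1}=\frac{-2\,dt}{1+t^2}$, $\omega_{+1}^{+1}=\frac{2t\,dt}{1-t^2}$, $\omega_{-1}^{+1}=\frac{-2t\,dt}{1+t^2}$. Consider words in the letters $\omega_0,\omega_\sigma^\varepsilon$ ($\sigma,\varepsilon=\pm1$). $\mathfrak{A}^1$ is the $\mathbb{Q}$-span of the words not ending with $\omega_0$ (including the empty word $\mathbf 1$); equivalently it is spanned by the products of the words $z^{\varepsilon}_{s;\sigma}:=\omega_0^{s-1}\omega_\sigma^\varepsilon$ ($s\in\mathbb{N}$). $\mathfrak{A}^0\subset\mathfrak{A}^1$ is the $\mathbb{Q}$-span of the admissible words: $\mathbf 1$ and those words of $\mathfrak{A}^1$ not beginning with $\omega_{+1}^{+1}$ or $\omega_{+1}^{-1}$. For an admissible word $\int_0^1 f_1(t)dt\cdots f_p(t)dt=\int_{1>t_1>\cdots>t_p>0}f_1(t_1)\cdots f_p(t_p)\,dt_1\cdots dt_p$, with value $1$ on $\mathbf 1$; $\mathtt{M}$ is extended linearly. For a word $w=z_{s_1;\sigma_1}^{\varepsilon_1}\cdots z_{s_r;\sigma_r}^{\varepsilon_r}$ define $$\mathbf p(w)=\omega_0^{s_1-1}W_{\sigma_1}^{\varepsilon_1,\varepsilon_2}\,\omega_0^{s_2-1}W_{\sigma_1\sigma_2}^{\varepsilon_2,\varepsilon_3}\cdots\omega_0^{s_{r-1}-1}W_{\sigma_1\cdots\sigma_{r-1}}^{\varepsilon_{r-1},\varepsilon_r}\,\omega_0^{s_r-1}\omega_{\sigma_1\cdots\sigma_r}^{\varepsilon_r},$$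 where $W_\sigma^{\varepsilon,\varepsilon'}=-\omega_\sigma^{\varepsilon\varepsilon'}$ if $\sigma=\varepsilon'=-\varepsilon=-1$ and $W_\sigma^{\varepsilon,\varepsilon'}=\omega_\sigma^{\varepsilon\varepsilon'}$ otherwise; and, with $\eta_j=\prod_{n=j}^r\varepsilon_n$, $$\mathbf q(w)=(-1)^{\#\{l<r\,:\,\sigma_l=\varepsilon_l=\eta_{l+1}=-1\}}\;\omega_0^{s_1-1}\omega_{\sigma_1}^{\eta_1}\,\omega_0^{s_2-1}\omega_{\sigma_1\sigma_2}^{\eta_2}\cdots\omega_0^{s_r-1}\omega_{\sigma_{r-1}\sigma_r}^{\eta_r}.$$ Set $\mathbf p(\mathbf 1)=\mathbf q(\mathbf 1)=\mathbf 1$ and extend linearly to $\mathfrak{A}^1$; $\mathbf p$ and $\mathbf q$ are mutually inverse. Let $*$ be the bilinear product on $\mathfrak{A}^1$ with unit $\mathbf 1$ and $$z^{\varepsilon_1}_{s;\sigma_1}u*z^{\varepsilon_2}_{t;\sigma_2}v=z^{\varepsilon_1}_{s;\sigma_1}\big(u*z^{\varepsilon_2}_{t;\sigma_2}v\big)+z^{\varepsilon_2}_{t;\sigma_2}\big(z^{\varepsilon_1}_{s;\sigma_1}u*v\big)+2\,\delta(\varepsilon_1,\varepsilon_2)\,z^{\varepsilon_1}_{s+t;\sigma_1\sigma_2}(u*v),$$ with $\delta$ the Kronecker symbol. Then $u\star v:=\mathbf p\big(\mathbf q(u)*\mathbf q(v)\big)$ for $u,v\in\mathfrak{A}^1$;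 it restricts to $\mathfrak{A}^0$. *)

theory Defs
  imports "HOL-Library.Poly_Mapping" "HOL-Analysis.Analysis"
begin

datatype sign = Plus | Minus

instantiation sign :: comm_monoid_mult
begin

definition one_sign :: sign where "one_sign = Plus"

definition times_sign :: "sign \<Rightarrow> sign \<Rightarrow> sign" where
  "times_sign a b = (if a = b then Plus else Minus)"

instance
  by standard (auto simp: one_sign_def times_sign_def; metis sign.exhaust)+

end

text \<open>\<open>Omega \<sigma> \<epsilon>\<close> is the letter with lower index \<open>\<sigma>\<close> and upper index \<open>\<epsilon>\<close>.\<close>

datatype letter = Omega0 | Omega sign sign

text \<open>The coefficient of \<open>dt\<close> in each of the 1-forms.\<close>

fun form :: "letter \<Rightarrow> real \<Rightarrow> real" where
  "form Omega0 t = 1 / t"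
| "form (Omega Plus Minus) t = 2 / (1 - t\<^sup>2)"
| "form (Omega Minus Minus) t = - 2 / (1 + t\<^sup>2)"
| "form (Omega Plus Plus) t = 2 * t / (1 - t\<^sup>2)"
| "form (Omega Minus Plus) t = - 2 * t / (1 + t\<^sup>2)"

type_synonym words = "letter list \<Rightarrow>\<^sub>0 rat"

definition word :: "letter list \<Rightarrow> words" where
  "word w = Poly_Mapping.single w 1"

definition qscale :: "rat \<Rightarrow> words \<Rightarrow> words" where
  "qscale c x = Poly_Mapping.map ((*) c) x"

definition extend :: "(letter list \<Rightarrow> words) \<Rightarrow> words \<Rightarrow> words" where
  "extend f x = (\<Sum>w\<in>Poly_Mapping.keys x. qscale (Poly_Mapping.lookup x w) (f w))"

definition extend2 :: "(letter list \<Rightarrow> letter list \<Rightarrow> words) \<Rightarrow> words \<Rightarrow> words \<Rightarrow> words" where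
  "extend2 f x y = (\<Sum>u\<in>Poly_Mapping.keys x. \<Sum>v\<in>Poly_Mapping.keys y.
     qscale (Poly_Mapping.lookup x u * Poly_Mapping.lookup y v) (f u v))"

definition conc :: "words \<Rightarrow> words \<Rightarrow> words" where
  "conc = extend2 (\<lambda>u v. word (u @ v))"

definition A1_word :: "letter list \<Rightarrow> bool" where
  "A1_word w \<longleftrightarrow> w = [] \<or> last w \<noteq> Omega0"

definition admissible :: "letter list \<Rightarrow> bool" where
  "admissible w \<longleftrightarrow> A1_word w \<and> (w = [] \<or> hd w \<notin> {Omega Plus Plus, Omega Plus Minus})"

definition A1 :: "words set" where
  "A1 = {x. \<forall>w\<in>Poly_Mapping.keys x. A1_word w}"

definition A0 :: "words set" where
  "A0 = {x. \<forall>w\<in>Poly_Mapping.keys x. admissible w}"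

text \<open>A triple \<open>(s, \<sigma>, \<epsilon>)\<close> with \<open>s \<ge> 1\<close> stands for
  \<open>z\<close> with lower index \<open>s; \<sigma>\<close> and upper index \<open>\<epsilon>\<close>.\<close>

type_synonym z = "nat \<times> sign \<times> sign"

fun zword :: "z \<Rightarrow> letter list" where
  "zword (s, \<sigma>, \<epsilon>) = replicate (s - 1) Omega0 @ [Omega \<sigma> \<epsilon>]"

text \<open>\<open>factor\<close> writes a word not ending in \<open>Omega0\<close> uniquely as a product of \<open>z\<close>'s
  (lemmas \<open>concat_factor\<close> and \<open>factor_concat\<close> below). The accumulator is one more than the
  number of letters \<open>Omega0\<close> read since the last other letter.\<close>

fun factor_acc :: "nat \<Rightarrow> letter list \<Rightarrow> z list" where
  "factor_acc s [] = []"
| "factor_acc s (Omega0 # w) = factor_acc (Suc s) w"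
| "factor_acc s (Omega \<sigma> \<epsilon> # w) = (s, \<sigma>, \<epsilon>) # factor_acc 1 w"

definition factor :: "letter list \<Rightarrow> z list" where
  "factor = factor_acc 1"

lemma concat_factor_acc:
  assumes "w = [] \<longrightarrow> s = 1" "A1_word w" "s \<ge> 1"
  shows "concat (map zword (factor_acc s w)) = replicate (s - 1) Omega0 @ w"
  using assms
proof (induction s w rule: factor_acc.induct)
  case (2 s w)
  then have "w \<noteq> []" "A1_word w" by (auto simp: A1_word_def split: if_splits)
  with 2 show ?case
    by (cases s) (auto simp flip: replicate_append_same)
next
  case (3 s \<sigma> \<epsilon> w)
  then show ?case by (auto simp: A1_word_def split: if_splits)
qed auto

lemma concat_factor: "A1_word w \<Longrightarrow> concat (map zword (factor w)) = w"
  using concat_factor_acc[of w 1] by (simp add: factor_def)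

lemma factor_acc_replicate: "factor_acc s (replicate n Omega0 @ w) = factor_acc (s + n) w"
  by (induction n arbitrary: s) auto

lemma factor_concat:
  "\<forall>(s, _)\<in>set zs. s \<ge> 1 \<Longrightarrow> factor (concat (map zword zs)) = zs"
  by (induction zs) (auto simp: factor_def factor_acc_replicate)

definition W :: "sign \<Rightarrow> sign \<Rightarrow> sign \<Rightarrow> words" where
  "W \<sigma> \<epsilon> \<epsilon>' =
     (if \<sigma> = Minus \<and> \<epsilon> = Plus \<and> \<epsilon>' = Minus then - word [Omega \<sigma> (\<epsilon> * \<epsilon>')]
      else word [Omega \<sigma> (\<epsilon> * \<epsilon>')])"

text \<open>The first argument of \<open>p_acc\<close> is the product of the \<open>\<sigma>\<close>'s already read.\<close>

fun p_acc :: "sign \<Rightarrow> z list \<Rightarrow> words" where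
  "p_acc \<tau> [] = word []"
| "p_acc \<tau> [(s, \<sigma>, \<epsilon>)] = word (replicate (s - 1) Omega0 @ [Omega (\<tau> * \<sigma>) \<epsilon>])"
| "p_acc \<tau> ((s, \<sigma>, \<epsilon>) # (s', \<sigma>', \<epsilon>') # zs) =
     conc (word (replicate (s - 1) Omega0))
       (conc (W (\<tau> * \<sigma>) \<epsilon> \<epsilon>') (p_acc (\<tau> * \<sigma>) ((s', \<sigma>', \<epsilon>') # zs)))"

definition p_map :: "words \<Rightarrow> words" where
  "p_map = extend (\<lambda>w. p_acc 1 (factor w))"

text \<open>Positions are counted from 0; the missing predecessor of the first \<open>\<sigma>\<close> is 1.\<close>

definition q_word :: "z list \<Rightarrow> words" where
  "q_word zs =
    (let r = length zs;
         s = (\<lambda>j. fst (zs ! j));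
         \<sigma> = (\<lambda>j. fst (snd (zs ! j)));
         \<epsilon> = (\<lambda>j. snd (snd (zs ! j)));
         \<eta> = (\<lambda>j. \<Prod>n=j..<r. \<epsilon> n)
     in qscale ((-1) ^ card {l. l + 1 < r \<and> \<sigma> l = Minus \<and> \<epsilon> l = Minus \<and> \<eta> (l + 1) = Minus})
          (word (concat (map
             (\<lambda>j. zword (s j, (if j = 0 then 1 else \<sigma> (j - 1)) * \<sigma> j, \<eta> j)) [0..<r]))))"

definition q_map :: "words \<Rightarrow> words" where
  "q_map = extend (\<lambda>w. q_word (factor w))"

fun stuffle_word :: "z list \<Rightarrow> z list \<Rightarrow> words" where
  "stuffle_word [] v = word (concat (map zword v))"
| "stuffle_word u [] = word (concat (map zword u))"
| "stuffle_word ((s, \<sigma>\<^sub>1, \<epsilon>\<^sub>1) # u) ((t, \<sigma>\<^sub>2, \<epsilon>\<^sub>2) # v) =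
     conc (word (zword (s, \<sigma>\<^sub>1, \<epsilon>\<^sub>1))) (stuffle_word u ((t, \<sigma>\<^sub>2, \<epsilon>\<^sub>2) # v))
   + conc (word (zword (t, \<sigma>\<^sub>2, \<epsilon>\<^sub>2))) (stuffle_word ((s, \<sigma>\<^sub>1, \<epsilon>\<^sub>1) # u) v)
   + qscale (2 * of_bool (\<epsilon>\<^sub>1 = \<epsilon>\<^sub>2))
       (conc (word (zword (s + t, \<sigma>\<^sub>1 * \<sigma>\<^sub>2, \<epsilon>\<^sub>1))) (stuffle_word u v))"

definition stuffle :: "words \<Rightarrow> words \<Rightarrow> words" where
  "stuffle = extend2 (\<lambda>u v. stuffle_word (factor u) (factor v))"

definition star :: "words \<Rightarrow> words \<Rightarrow> words"  (infixl "\<star>" 70) where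
  "u \<star> v = p_map (stuffle (q_map u) (q_map v))"

text \<open>The region \<open>1 > t\<^sub>1 > \<dots> > t\<^sub>n > 0\<close>, with \<open>t\<^sub>i\<close> written \<open>t (i - 1)\<close>. For the empty word
  the integral below is that of the constant 1 over a one-point space, that is, 1.\<close>

definition simplex_region :: "nat \<Rightarrow> (nat \<Rightarrow> real) set" where
  "simplex_region n =
     {t. (\<forall>i<n. 0 < t i \<and> t i < 1) \<and> (\<forall>i. Suc i < n \<longrightarrow> t (Suc i) < t i)}"

definition int_converges :: "letter list \<Rightarrow> bool" where
  "int_converges w \<longleftrightarrow>
     set_integrable (Pi\<^sub>M {..<length w} (\<lambda>_. lborel)) (simplex_region (length w))
       (\<lambda>t. \<Prod>i<length w. form (w ! i) (t i))"

definition iter_int :: "letter list \<Rightarrow> real" where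
  "iter_int w =
     set_lebesgue_integral (Pi\<^sub>M {..<length w} (\<lambda>_. lborel)) (simplex_region (length w))
       (\<lambda>t. \<Prod>i<length w. form (w ! i) (t i))"

definition M_map :: "words \<Rightarrow> real" where
  "M_map x = (\<Sum>w\<in>Poly_Mapping.keys x. of_rat (Poly_Mapping.lookup x w) * iter_int w)"

end

(* Expanding the forms in geometric series shows that the integral of a word up to t is a power
   series in t whose coefficients are, up to sign, those of a nested sum over n_1 > ... > n_r
   with parity conditions on the n_j.  The maps q and p pass between the
   two encodings; their signs come from ceil((n - m)/2) versus ceil(n/2) - ceil(m/2).  Sums truncated
   at n_1 < N multiply exactly by the quasi-shuffle product, so it remains to let N tend to
   infinity.  For an admissible word the series at t = 1 converges, only conditionally if the word
   begins with omega_{-1}, and Abel's theorem identifies its sum with the integral.  All forms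
   have constant sign on (0, 1), so the integral itself is computed with nonnegative integrands
   (Tonelli and the fundamental theorem of calculus), which also gives its convergence. *)

theory Submission
  imports Defs
begin

text \<open>A word and its factorization into z's read one nested sum in different coordinates: a
  letter \<open>Omega \<sigma> \<epsilon>\<close> sees only the gap n_j - n_{j+1}, while a factor in
  the stuffle product sees n_j itself. Gap parities multiply up to the parity of n_j, whence the
  \<eta>_j in q. The character of a gap splits into a part at n_j and a part at n_{j+1}; the latter
  joins the next letter, whence the lower indices \<sigma>_{j-1} \<sigma>_j. The quasi-shuffle rule
  compares the outermost indices of two sums, and for t < 1 the weights t^n t^m do not combine to
  t^max(n, m). This is why the sums are cut off rather than damped, and why convergence at t = 1
  needs a proof of its own before Abel's theorem applies. The general bound on the coefficients is
  only a power of log n over n; a leading \<open>Omega0\<close> gains another 1/n, whereas a leading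
  lower index -1 has to supply cancellation.\<close>

section \<open>Linear functionals on the space of words\<close>

text \<open>Both \<open>M_map\<close> and the truncated sums have this shape, so linearity is
  settled once for an arbitrary \<phi>.\<close>

definition eval_words :: "(letter list \<Rightarrow> real) \<Rightarrow> words \<Rightarrow> real" where
  "eval_words \<phi> x = (\<Sum>w\<in>Poly_Mapping.keys x. of_rat (Poly_Mapping.lookup x w) * \<phi> w)"

lemma lookup_qscale [simp]: "Poly_Mapping.lookup (qscale c x) w = c * Poly_Mapping.lookup x w"
  by (simp add: qscale_def Poly_Mapping.map.rep_eq when_def)

lemma keys_qscale: "Poly_Mapping.keys (qscale c x) \<subseteq> Poly_Mapping.keys x"
  by (auto simp: in_keys_iff)

text \<open>Keys may cancel in a sum; \<open>x\<close>, \<open>y\<close> and \<open>x + y\<close>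
  become comparable over one common finite set of words.\<close>

lemma eval_words_superset:
  assumes "finite S" "Poly_Mapping.keys x \<subseteq> S"
  shows "eval_words \<phi> x = (\<Sum>w\<in>S. of_rat (Poly_Mapping.lookup x w) * \<phi> w)"
  unfolding eval_words_def using assms by (intro sum.mono_neutral_left) (auto simp: in_keys_iff)

lemma eval_words_0 [simp]: "eval_words \<phi> 0 = 0"
  by (simp add: eval_words_def)

lemma eval_words_add [simp]: "eval_words \<phi> (x + y) = eval_words \<phi> x + eval_words \<phi> y"
proof -
  let ?S = "Poly_Mapping.keys x \<union> Poly_Mapping.keys y"
  have "eval_words \<phi> z = (\<Sum>w\<in>?S. of_rat (Poly_Mapping.lookup z w) * \<phi> w)"
    if "z \<in> {x, y, x + y}" for z
    using that Poly_Mapping.keys_add[of x y] by (intro eval_words_superset) auto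
  then show ?thesis
    by (simp add: lookup_add of_rat_add algebra_simps sum.distrib)
qed

lemma eval_words_qscale [simp]: "eval_words \<phi> (qscale c x) = of_rat c * eval_words \<phi> x"
  by (subst eval_words_superset[OF _ keys_qscale])
     (simp_all add: eval_words_def of_rat_mult sum_distrib_left mult.assoc)

lemma eval_words_word [simp]: "eval_words \<phi> (word w) = \<phi> w"
  by (simp add: eval_words_def word_def)

lemma eval_words_sum [simp]: "eval_words \<phi> (\<Sum>i\<in>I. f i) = (\<Sum>i\<in>I. eval_words \<phi> (f i))"
  by (induction I rule: infinite_finite_induct) auto

lemma eval_words_sum_fun:
  "eval_words (\<lambda>w. \<Sum>i\<in>I. c i * \<phi> i w) x = (\<Sum>i\<in>I. c i * eval_words (\<phi> i) x)"
  unfolding eval_words_def sum_distrib_left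
  by (subst sum.swap) (simp add: algebra_simps)

lemma eval_words_cong:
  "(\<And>w. w \<in> Poly_Mapping.keys x \<Longrightarrow> \<phi> w = \<psi> w) \<Longrightarrow> eval_words \<phi> x = eval_words \<psi> x"
  by (simp add: eval_words_def)

lemma eval_words_extend: "eval_words \<phi> (extend f x) = eval_words (\<lambda>w. eval_words \<phi> (f w)) x"
  by (simp add: extend_def eval_words_def[of _ x])

lemma eval_words_extend2:
  "eval_words \<phi> (extend2 f x y) = eval_words (\<lambda>u. eval_words (\<lambda>v. eval_words \<phi> (f u v)) y) x"
  by (simp add: extend2_def eval_words_def[of _ x] eval_words_def[of _ y] of_rat_mult
      sum_distrib_left mult.assoc)

lemma eval_words_product:
  "eval_words f x * eval_words g y = eval_words (\<lambda>u. eval_words (\<lambda>v. f u * g v) y) x"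
  unfolding eval_words_def sum_product unfolding sum_distrib_left by (simp only: mult_ac)

lemma conc_word: "conc (word u) x = extend (\<lambda>v. word (u @ v)) x"
  by (simp add: conc_def extend2_def extend_def word_def)

lemma conc_word_qscale [simp]:
  "conc (word u) (qscale c (word v)) = qscale c (word (u @ v))"
proof (cases "c = 0")
  \<comment> \<open>With coefficient 0 the key set is empty rather than \<open>{v}\<close>.\<close>
  case True
  then have "qscale c x = 0" for x by (intro poly_mapping_eqI) simp
  then show ?thesis by (simp add: conc_word extend_def)
next
  case False
  then have "Poly_Mapping.keys (qscale c (word v)) = {v}"
    by (auto simp: in_keys_iff word_def lookup_single when_def split: if_splits)
  then show ?thesis by (simp add: conc_word extend_def) (simp add: word_def)
qed

lemma qscale_1 [simp]: "qscale 1 x = x"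
  by (intro poly_mapping_eqI) simp

lemma qscale_qscale [simp]: "qscale c (qscale d x) = qscale (c * d) x"
  by (intro poly_mapping_eqI) simp

lemma eval_words_conc_word:
  "eval_words \<phi> (conc (word u) x) = eval_words (\<lambda>v. \<phi> (u @ v)) x"
  by (simp add: conc_word eval_words_extend)

section \<open>Subspaces spanned by words with a given property\<close>

definition words_on :: "(letter list \<Rightarrow> bool) \<Rightarrow> words set" where
  "words_on P = {x. \<forall>w\<in>Poly_Mapping.keys x. P w}"

lemma words_on_word [simp]: "word w \<in> words_on P \<longleftrightarrow> P w"
  by (simp add: words_on_def word_def)

lemma words_on_0 [simp]: "0 \<in> words_on P"
  by (simp add: words_on_def)

lemma words_on_add: "x \<in> words_on P \<Longrightarrow> y \<in> words_on P \<Longrightarrow> x + y \<in> words_on P"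
  using Poly_Mapping.keys_add[of x y] by (auto simp: words_on_def)

lemma words_on_qscale: "x \<in> words_on P \<Longrightarrow> qscale c x \<in> words_on P"
  using keys_qscale[of c x] by (auto simp: words_on_def)

lemma words_on_sum: "(\<And>i. i \<in> I \<Longrightarrow> f i \<in> words_on P) \<Longrightarrow> (\<Sum>i\<in>I. f i) \<in> words_on P"
  by (induction I rule: infinite_finite_induct) (auto intro: words_on_add)

lemma words_on_extend:
  "x \<in> words_on P \<Longrightarrow> (\<And>w. P w \<Longrightarrow> f w \<in> words_on Q) \<Longrightarrow> extend f x \<in> words_on Q"
  unfolding extend_def by (intro words_on_sum words_on_qscale) (auto simp: words_on_def)

lemma words_on_extend2:
  assumes "x \<in> words_on P" "y \<in> words_on P'"
    and "\<And>u v. P u \<Longrightarrow> P' v \<Longrightarrow> f u v \<in> words_on Q"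
  shows "extend2 f x y \<in> words_on Q"
  unfolding extend2_def
  by (intro words_on_sum words_on_qscale assms(3)) (use assms(1,2) in \<open>auto simp: words_on_def\<close>)

lemma words_on_conc_word:
  "x \<in> words_on P \<Longrightarrow> (\<And>w. P w \<Longrightarrow> Q (u @ w)) \<Longrightarrow> conc (word u) x \<in> words_on Q"
  unfolding conc_word by (rule words_on_extend[of x P]) auto

section \<open>Coefficients\<close>

lemma sign_mult_simps [simp]:
  "Plus * x = x" "x * Plus = x" "(1::sign) = Plus" "Minus * Minus = Plus" "x * x = (Plus::sign)"
  by (cases x; simp add: times_sign_def one_sign_def)+

lemma sign_mult_cancel [simp]: "x * (x * y) = (y::sign)"
  by (simp flip: mult.assoc)

fun sgn_of :: "sign \<Rightarrow> real" where
  "sgn_of Plus = 1" | "sgn_of Minus = -1"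

definition parity_sign :: "nat \<Rightarrow> sign" where
  "parity_sign n = (if even n then Plus else Minus)"

text \<open>The exponent is ceil(n/2). It grows by one from n to n + 2, so it records the signs of a
  geometric series in t^2 for even and for odd exponents alike.\<close>

definition chi :: "sign \<Rightarrow> nat \<Rightarrow> real" where
  "chi \<sigma> n = sgn_of \<sigma> ^ ((n + 1) div 2)"

text \<open>The power series \<open>\<Sum>k. form_coeff \<sigma> \<epsilon> k * t ^ k\<close> is \<open>t * form (Omega \<sigma> \<epsilon>) t\<close>.\<close>

definition form_coeff :: "sign \<Rightarrow> sign \<Rightarrow> nat \<Rightarrow> real" where
  "form_coeff \<sigma> \<epsilon> n = (if n > 0 \<and> parity_sign n = \<epsilon> then 2 * chi \<sigma> n else 0)"

text \<open>\<open>mcoeff\<close> is the part \<open>n\<^sub>1 = n\<close> of the nested sum over \<open>n\<^sub>1 > \<dots> > n\<^sub>r\<close>, and \<open>wcoeff\<close> the coefficient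
  of \<open>t ^ n\<close> in the iterated integral of a word over \<open>t > t\<^sub>1 > t\<^sub>2 > \<dots>\<close>. The coefficient at \<open>n = 0\<close> of a
  word beginning with \<open>Omega0\<close> is 0 because \<open>x / 0 = 0\<close>.\<close>

fun mcoeff :: "z list \<Rightarrow> nat \<Rightarrow> real" where
  "mcoeff [] n = of_bool (n = 0)"
| "mcoeff ((s, \<sigma>, \<epsilon>) # zs) n = form_coeff \<sigma> \<epsilon> n / real n ^ s * (\<Sum>m<n. mcoeff zs m)"

fun wcoeff :: "letter list \<Rightarrow> nat \<Rightarrow> real" where
  "wcoeff [] n = of_bool (n = 0)"
| "wcoeff (Omega0 # w) n = wcoeff w n / real n"
| "wcoeff (Omega \<sigma> \<epsilon> # w) n = (\<Sum>m<n. form_coeff \<sigma> \<epsilon> (n - m) * wcoeff w m) / real n"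

definition msum :: "nat \<Rightarrow> z list \<Rightarrow> real" where
  "msum N zs = (\<Sum>n<N. mcoeff zs n)"

definition wsum :: "nat \<Rightarrow> letter list \<Rightarrow> real" where
  "wsum N w = (\<Sum>n<N. wcoeff w n)"

definition valid :: "z list \<Rightarrow> bool" where
  "valid zs \<longleftrightarrow> (\<forall>(s, _)\<in>set zs. s \<ge> 1)"

definition unfactor :: "z list \<Rightarrow> letter list" where
  "unfactor zs = concat (map zword zs)"

lemma valid_simps [simp]: "valid []" "valid ((s, x) # zs) \<longleftrightarrow> s \<ge> 1 \<and> valid zs"
  by (auto simp: valid_def)

lemma unfactor_simps [simp]: "unfactor [] = []" "unfactor (z # zs) = zword z @ unfactor zs"
  by (auto simp: unfactor_def)

lemma valid_factor_acc: "s \<ge> 1 \<Longrightarrow> valid (factor_acc s w)"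
  by (induction s w rule: factor_acc.induct) auto

lemma valid_factor [simp]: "valid (factor w)"
  by (simp add: factor_def valid_factor_acc)

lemma factor_unfactor [simp]: "valid zs \<Longrightarrow> factor (unfactor zs) = zs"
  unfolding unfactor_def valid_def by (rule factor_concat)

lemma unfactor_factor: "A1_word w \<Longrightarrow> unfactor (factor w) = w"
  unfolding unfactor_def by (rule concat_factor)

lemma A1_unfactor [simp]: "A1_word (unfactor zs)"
  by (induction zs) (auto simp: A1_word_def last_append split: if_splits)

lemma factor_zword_append: "s \<ge> 1 \<Longrightarrow> factor (zword (s, \<sigma>, \<epsilon>) @ w) = (s, \<sigma>, \<epsilon>) # factor w"
  by (simp add: factor_def factor_acc_replicate)

lemma chi_simps: "chi (\<sigma> * \<tau>) n = chi \<sigma> n * chi \<tau> n" "chi Plus n = 1" "chi \<sigma> n * chi \<sigma> n = 1"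
  by (cases \<sigma>; cases \<tau>; simp add: chi_def times_sign_def flip: power_mult_distrib)+

text \<open>The origin of the sign in \<^const>\<open>W\<close>.\<close>

lemma chi_diff:
  assumes "m \<le> n"
  shows "chi \<sigma> (n - m) =
    (if \<sigma> = Minus \<and> parity_sign n = Plus \<and> parity_sign m = Minus then -1 else 1) * chi \<sigma> n * chi \<sigma> m"
proof -
  obtain k where n: "n = m + k" using assms le_Suc_ex by blast
  have "(- 1) ^ ((k + 1) div 2) = (if even n \<and> odd m then -1 else 1) *
    (- 1) ^ ((n + 1) div 2) * (- 1 :: real) ^ ((m + 1) div 2)"
  proof -
    obtain a where a: "m = 2 * a \<or> m = 2 * a + 1" by (metis oddE evenE)
    obtain b where b: "k = 2 * b \<or> k = 2 * b + 1" by (metis oddE evenE)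
    have sq: "(- 1 :: real) ^ a * ((- 1) ^ a * x) = x" for x
      by (simp flip: mult.assoc power_mult_distrib)
    from a b show ?thesis
    proof (elim disjE)
      assume *: "m = 2 * a + 1" "k = 2 * b + 1"
      then have "(n + 1) div 2 = a + b + 1" "(m + 1) div 2 = a + 1" "(k + 1) div 2 = b + 1"
        by (auto simp: n)
      then show ?thesis using * sq by (simp add: n power_add)
    next
      assume *: "m = 2 * a + 1" "k = 2 * b"
      then have "(n + 1) div 2 = a + b + 1" "(m + 1) div 2 = a + 1" "(k + 1) div 2 = b"
        by (auto simp: n)
      then show ?thesis using * sq by (simp add: n power_add)
    next
      assume *: "m = 2 * a" "k = 2 * b + 1"
      then have "(n + 1) div 2 = a + b + 1" "(m + 1) div 2 = a" "(k + 1) div 2 = b + 1"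
        by (auto simp: n)
      then show ?thesis using * sq by (simp add: n power_add)
    next
      assume *: "m = 2 * a" "k = 2 * b"
      then have "(n + 1) div 2 = a + b" "(m + 1) div 2 = a" "(k + 1) div 2 = b"
        by (auto simp: n)
      then show ?thesis using * sq by (simp add: n power_add)
    qed
  qed
  then show ?thesis
    by (cases \<sigma>) (simp_all add: n chi_def parity_sign_def)
qed

lemma parity_sign_diff: "m \<le> n \<Longrightarrow> parity_sign (n - m) = parity_sign n * parity_sign m"
  by (auto simp: parity_sign_def times_sign_def)

section \<open>Truncated sums: quasi-shuffle\<close>

text \<open>The square of index pairs is cut into the two sides of its diagonal and the diagonal
  itself, which become the three terms of \<open>stuffle_word\<close>.\<close>

lemma sum_mult_sum_split:
  fixes f g :: "nat \<Rightarrow> real"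
  shows "(\<Sum>n<N. f n) * (\<Sum>n<N. g n) =
    (\<Sum>n<N. f n * (\<Sum>m<n. g m)) + (\<Sum>n<N. g n * (\<Sum>m<n. f m)) + (\<Sum>n<N. f n * g n)"
  by (induction N) (simp_all add: algebra_simps)

text \<open>Each form contributes a factor 2 and a parity condition; on the diagonal one 2 is left
  over and the parities must agree. This is the coefficient 2 \<delta>(\<epsilon>, \<epsilon>') of
  the stuffle product.\<close>

lemma form_coeff_mult:
  "form_coeff \<sigma> \<epsilon> n * form_coeff \<tau> \<epsilon>' n = 2 * of_bool (\<epsilon> = \<epsilon>') * form_coeff (\<sigma> * \<tau>) \<epsilon> n"
  by (simp add: form_coeff_def chi_simps)

lemma msum_Nil: "msum N [] = of_bool (N \<noteq> 0)"
  by (induction N) (auto simp: msum_def)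

lemma msum_0 [simp]: "msum 0 zs = 0"
  by (simp add: msum_def)

lemma msum_Cons:
  "msum N ((s, \<sigma>, \<epsilon>) # zs) = (\<Sum>n<N. form_coeff \<sigma> \<epsilon> n / real n ^ s * msum n zs)"
  by (simp add: msum_def)

text \<open>A new first z fixes the outermost index n, and what follows is again a truncated sum,
  with bound n in place of \<open>N\<close>.\<close>

lemma eval_msum_conc_zword:
  assumes "s \<ge> 1"
  shows "eval_words (\<lambda>w. msum N (factor w)) (conc (word (zword (s, \<sigma>, \<epsilon>))) x) =
    (\<Sum>n<N. form_coeff \<sigma> \<epsilon> n / real n ^ s * eval_words (\<lambda>w. msum n (factor w)) x)"
  using assms
  by (simp add: eval_words_conc_word factor_zword_append msum_Cons eval_words_sum_fun
      del: zword.simps times_divide_eq_left times_divide_eq_right)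

text \<open>The bound \<open>N\<close> is generalized in the induction because splitting off an
  outermost index n leaves tails truncated at n.\<close>

lemma eval_msum_stuffle_word:
  assumes "valid u" "valid v"
  shows "eval_words (\<lambda>w. msum N (factor w)) (stuffle_word u v) = msum N u * msum N v"
  using assms
proof (induction u v arbitrary: N rule: stuffle_word.induct)
  case (3 s \<sigma>1 \<epsilon>1 u t \<sigma>2 \<epsilon>2 v)
  let ?f = "\<lambda>s \<sigma> \<epsilon> n. form_coeff \<sigma> \<epsilon> n / real n ^ s"
  let ?u = "(s, \<sigma>1, \<epsilon>1) # u" and ?v = "(t, \<sigma>2, \<epsilon>2) # v"
  have diag: "?f s \<sigma>1 \<epsilon>1 n * ?f t \<sigma>2 \<epsilon>2 n = 2 * of_bool (\<epsilon>1 = \<epsilon>2) * ?f (s + t) (\<sigma>1 * \<sigma>2) \<epsilon>1 n" for n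
    using form_coeff_mult[of \<sigma>1 \<epsilon>1 n \<sigma>2 \<epsilon>2] by (simp add: power_add field_simps)
  have "msum N ?u * msum N ?v =
    (\<Sum>n<N. ?f s \<sigma>1 \<epsilon>1 n * msum n u * msum n ?v) +
    (\<Sum>n<N. ?f t \<sigma>2 \<epsilon>2 n * msum n v * msum n ?u) +
    (\<Sum>n<N. ?f s \<sigma>1 \<epsilon>1 n * msum n u * (?f t \<sigma>2 \<epsilon>2 n * msum n v))"
    by (simp only: msum_Cons sum_mult_sum_split)
  also have "(\<Sum>n<N. ?f s \<sigma>1 \<epsilon>1 n * msum n u * (?f t \<sigma>2 \<epsilon>2 n * msum n v)) =
    (\<Sum>n<N. (?f s \<sigma>1 \<epsilon>1 n * ?f t \<sigma>2 \<epsilon>2 n) * (msum n u * msum n v))"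
    by (simp only: mult_ac)
  also have "\<dots> = 2 * of_bool (\<epsilon>1 = \<epsilon>2) * (\<Sum>n<N. ?f (s + t) (\<sigma>1 * \<sigma>2) \<epsilon>1 n * (msum n u * msum n v))"
    by (simp only: diag mult.assoc sum_distrib_left)
  finally have "msum N ?u * msum N ?v =
    (\<Sum>n<N. ?f s \<sigma>1 \<epsilon>1 n * (msum n u * msum n ?v)) +
    (\<Sum>n<N. ?f t \<sigma>2 \<epsilon>2 n * (msum n ?u * msum n v)) +
    2 * of_bool (\<epsilon>1 = \<epsilon>2) * (\<Sum>n<N. ?f (s + t) (\<sigma>1 * \<sigma>2) \<epsilon>1 n * (msum n u * msum n v))"
    by (simp only: mult_ac)
  moreover have "s + t \<ge> 1" using 3 by simp
  ultimately show ?case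
    using 3 by (simp only: stuffle_word.simps eval_words_add eval_words_qscale
        eval_msum_conc_zword valid_simps) (simp add: of_rat_mult)
next
  case (1 v)
  then show ?case
    \<comment> \<open>For \<open>N = 0\<close> all truncated sums vanish, that of the empty list
      included; it acts as a unit only for positive \<open>N\<close>.\<close>
    by (cases "N = 0") (simp_all add: msum_Nil flip: unfactor_def)
next
  case (2 z u)
  then have "stuffle_word (z # u) [] = word (unfactor (z # u))"
    by (simp add: unfactor_def)
  with 2 show ?case
    by (cases "N = 0") (simp_all add: msum_Nil del: unfactor_simps stuffle_word.simps)
qed

section \<open>The maps p and q\<close>

fun eta :: "z list \<Rightarrow> sign" where
  "eta [] = Plus"
| "eta ((s, \<sigma>, \<epsilon>) # zs) = \<epsilon> * eta zs"

text \<open>\<open>qlist\<close> and \<open>plist\<close> are q and p without their signs; \<open>\<tau>\<close> is the preceding \<open>\<sigma>\<close> for \<open>qlist\<close> and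
  the product of all preceding ones for \<open>plist\<close>.\<close>

fun qlist :: "sign \<Rightarrow> z list \<Rightarrow> z list" where
  "qlist \<tau> [] = []"
| "qlist \<tau> ((s, \<sigma>, \<epsilon>) # zs) = (s, \<tau> * \<sigma>, \<epsilon> * eta zs) # qlist \<sigma> zs"

fun plist :: "sign \<Rightarrow> z list \<Rightarrow> z list" where
  "plist \<tau> [] = []"
| "plist \<tau> ((s, \<sigma>, \<epsilon>) # zs) =
     (s, \<tau> * \<sigma>, \<epsilon> * (case zs of [] \<Rightarrow> Plus | (_, _, \<epsilon>') # _ \<Rightarrow> \<epsilon>')) # plist (\<tau> * \<sigma>) zs"

fun qsgn :: "z list \<Rightarrow> rat" where
  "qsgn [] = 1"
| "qsgn ((s, \<sigma>, \<epsilon>) # zs) =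
     (if \<sigma> = Minus \<and> \<epsilon> = Minus \<and> eta zs = Minus then -1 else 1) * qsgn zs"

lemma valid_qlist [simp]: "valid (qlist \<tau> zs) \<longleftrightarrow> valid zs"
  by (induction \<tau> zs rule: qlist.induct) auto

lemma valid_plist [simp]: "valid (plist \<tau> zs) \<longleftrightarrow> valid zs"
  by (induction \<tau> zs rule: plist.induct) auto

text \<open>The upper indices of \<open>plist\<close> are \<epsilon>_j \<epsilon>_{j+1}, so their
  product telescopes. This is what makes q undo p.\<close>

lemma eta_plist: "eta (plist \<tau> zs) = (case zs of [] \<Rightarrow> Plus | (_, _, \<epsilon>) # _ \<Rightarrow> \<epsilon>)"
  by (induction \<tau> zs rule: plist.induct) (auto simp: mult.assoc split: list.split)

lemma qlist_plist [simp]: "qlist \<tau> (plist \<tau> zs) = zs"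
  by (induction \<tau> zs rule: plist.induct) (auto simp: eta_plist mult.assoc split: list.split)

lemma qsgn_square [simp]: "qsgn zs * qsgn zs = 1"
  by (induction zs rule: qsgn.induct) (auto simp: algebra_simps)

lemma wcoeff_replicate: "wcoeff (replicate k Omega0 @ w) n = wcoeff w n / real n ^ k"
  by (induction k) (auto simp: field_simps)

text \<open>\<open>Omega0\<close> keeps the exponent, and every other letter raises it by a gap
  whose parity is its upper index.\<close>

lemma wcoeff_parity: "wcoeff (unfactor zs) n \<noteq> 0 \<Longrightarrow> parity_sign n = eta zs"
proof (induction zs arbitrary: n)
  case (Cons z zs)
  obtain s \<sigma> \<epsilon> where z: "z = (s, \<sigma>, \<epsilon>)" by (cases z)
  from Cons.prems have "(\<Sum>m<n. form_coeff \<sigma> \<epsilon> (n - m) * wcoeff (unfactor zs) m) \<noteq> 0"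
    by (auto simp: z wcoeff_replicate)
  then obtain m where "m < n" "form_coeff \<sigma> \<epsilon> (n - m) \<noteq> 0" "wcoeff (unfactor zs) m \<noteq> 0"
    by (metis (no_types, lifting) lessThan_iff mult_eq_0_iff sum.neutral)
  then have "parity_sign n * parity_sign m = \<epsilon>" "parity_sign m = eta zs"
    using Cons.IH by (auto simp: form_coeff_def parity_sign_diff split: if_splits)
  then show ?case by (auto simp: z mult.assoc)
qed (auto simp: parity_sign_def split: if_splits)

text \<open>The factor \<open>chi \<tau> n\<close> is what the preceding letter leaves behind when
  \<open>chi_diff\<close> splits the character of its gap. Carrying it along turns the lower index
  \<sigma> into \<tau> * \<sigma>, and the exceptional sign of \<open>chi_diff\<close> into a factor
  of \<open>qsgn\<close>.\<close>

lemma wcoeff_unfactor: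
  assumes "valid zs"
  shows "wcoeff (unfactor zs) n * chi \<tau> n = of_rat (qsgn zs) * mcoeff (qlist \<tau> zs) n"
  using assms
proof (induction \<tau> zs arbitrary: n rule: qlist.induct)
  case (2 \<tau> s \<sigma> \<epsilon> zs)
  define S where "S = (if \<sigma> = Minus \<and> \<epsilon> = Minus \<and> eta zs = Minus then -1 else 1 :: real)"
  have S: "of_rat (if \<sigma> = Minus \<and> \<epsilon> = Minus \<and> eta zs = Minus then -1 else 1 :: rat) = S"
    by (simp add: S_def)
  have *: "form_coeff \<sigma> \<epsilon> (n - m) * wcoeff (unfactor zs) m * chi \<tau> n =
    S * form_coeff (\<tau> * \<sigma>) (\<epsilon> * eta zs) n * (of_rat (qsgn zs) * mcoeff (qlist \<sigma> zs) m)"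
    if "m < n" for m
  proof (cases "wcoeff (unfactor zs) m = 0")
    \<comment> \<open>Outside the support of the tail its parity says nothing about m, but both
      sides vanish there, the right one by the induction hypothesis.\<close>
    case True
    then show ?thesis using 2 by (metis mult_zero_left mult_zero_right valid_simps(2))
  next
    case False
    from wcoeff_parity[OF this] have m: "parity_sign m = eta zs" .
    have eq: "parity_sign n * eta zs = \<epsilon> \<longleftrightarrow> parity_sign n = \<epsilon> * eta zs"
      by (cases \<epsilon>; cases "eta zs"; cases "parity_sign n"; simp add: times_sign_def)
    have IH: "wcoeff (unfactor zs) m * chi \<sigma> m = of_rat (qsgn zs) * mcoeff (qlist \<sigma> zs) m"
      using 2 by simp
    show ?thesis
    proof (cases "parity_sign n = \<epsilon> * eta zs")
      case True
      then have "chi \<sigma> (n - m) = S * chi \<sigma> n * chi \<sigma> m"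
        using that by (cases \<epsilon>; cases "eta zs"; simp add: chi_diff m S_def times_sign_def)
      then show ?thesis
        using that True eq IH[symmetric]
        by (simp add: form_coeff_def parity_sign_diff m chi_simps mult_ac)
    next
      case False
      then show ?thesis using that eq by (simp add: form_coeff_def parity_sign_diff m)
    qed
  qed
  \<comment> \<open>The \<open>s - 1\<close> letters \<open>Omega0\<close> and the letter ending the
    z divide by n once each, giving n^s.\<close>
  have "wcoeff (unfactor ((s, \<sigma>, \<epsilon>) # zs)) n * chi \<tau> n =
    (\<Sum>m<n. form_coeff \<sigma> \<epsilon> (n - m) * wcoeff (unfactor zs) m * chi \<tau> n) / real n ^ s"
    using 2(2) by (cases s) (auto simp: wcoeff_replicate simp flip: sum_distrib_right)
  also have "\<dots> = S * form_coeff (\<tau> * \<sigma>) (\<epsilon> * eta zs) n / real n ^ s * of_rat (qsgn zs) *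
      (\<Sum>m<n. mcoeff (qlist \<sigma> zs) m)"
  proof -
    have "(\<Sum>m<n. form_coeff \<sigma> \<epsilon> (n - m) * wcoeff (unfactor zs) m * chi \<tau> n) =
      (\<Sum>m<n. S * form_coeff (\<tau> * \<sigma>) (\<epsilon> * eta zs) n * (of_rat (qsgn zs) * mcoeff (qlist \<sigma> zs) m))"
      using * by (intro sum.cong) auto
    also have "\<dots> = S * form_coeff (\<tau> * \<sigma>) (\<epsilon> * eta zs) n * (of_rat (qsgn zs) * (\<Sum>m<n. mcoeff (qlist \<sigma> zs) m))"
      by (simp only: sum_distrib_left)
    finally show ?thesis by simp
  qed
  finally show ?case
    by (simp add: of_rat_mult S del: unfactor_simps)
next
  case (1 \<tau>)
  then show ?case by (cases "n = 0") (auto simp: chi_def)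
qed

lemma wsum_unfactor:
  "valid zs \<Longrightarrow> wsum N (unfactor zs) = of_rat (qsgn zs) * msum N (qlist Plus zs)"
  using wcoeff_unfactor[of zs _ Plus]
  by (simp add: wsum_def msum_def sum_distrib_left chi_simps)

lemma conc_qscale_word: "conc (qscale c (word u)) y = qscale c (conc (word u) y)"
proof (cases "c = 0")
  case True
  then show ?thesis
    by (intro poly_mapping_eqI) (simp add: conc_def extend2_def lookup_sum)
next
  case False
  then have "Poly_Mapping.keys (qscale c (word u)) = {u}"
    by (auto simp: in_keys_iff word_def lookup_single when_def split: if_splits)
  then show ?thesis
    by (intro poly_mapping_eqI)
      (simp add: conc_def extend2_def lookup_sum sum_distrib_left, simp add: word_def mult.assoc)
qed

text \<open>The sign of p is the sign of q at the image: \<epsilon> * \<epsilon>' and \<epsilon>'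
  are both \<open>Minus\<close> exactly when \<epsilon> is \<open>Plus\<close> and \<epsilon>' is
  \<open>Minus\<close>, the exceptional case of \<open>W\<close>. Hence the two signs cancel when q
  follows p.\<close>

lemma p_acc_eq: "p_acc \<tau> zs = qscale (qsgn (plist \<tau> zs)) (word (unfactor (plist \<tau> zs)))"
proof (induction \<tau> zs rule: p_acc.induct)
  case (3 \<tau> s \<sigma> \<epsilon> s' \<sigma>' \<epsilon>' zs)
  let ?r = "plist (\<tau> * \<sigma>) ((s', \<sigma>', \<epsilon>') # zs)"
  have e: "eta ?r = \<epsilon>'" by (simp only: eta_plist) simp
  have W: "W (\<tau> * \<sigma>) \<epsilon> \<epsilon>' = qscale (if \<tau> * \<sigma> = Minus \<and> \<epsilon> * \<epsilon>' = Minus \<and> \<epsilon>' = Minus then -1 else 1)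
      (word [Omega (\<tau> * \<sigma>) (\<epsilon> * \<epsilon>')])"
    by (intro poly_mapping_eqI; cases \<epsilon>; cases \<epsilon>') (auto simp: W_def times_sign_def)
  show ?case
    by (simp only: p_acc.simps 3 plist.simps(2)[of \<tau>] W conc_qscale_word conc_word_qscale list.case prod.case
       qsgn.simps(2) e)
      (simp add: mult_ac del: plist.simps)
qed auto

lemma eta_drop:
  assumes "j \<le> length zs"
  shows "eta (drop j zs) = (\<Prod>n=j..<length zs. snd (snd (zs ! n)))"
  using assms
proof (induction j rule: inc_induct)
  case (step j)
  then show ?case
    by (cases "zs ! j") (simp add: prod.atLeast_Suc_lessThan flip: Cons_nth_drop_Suc)
qed auto

lemma length_qlist [simp]: "length (qlist \<tau> zs) = length zs"
  by (induction \<tau> zs rule: qlist.induct) auto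

lemma nth_qlist:
  assumes "j < length zs"
  shows "qlist \<tau> zs ! j =
    (fst (zs ! j), (if j = 0 then \<tau> else fst (snd (zs ! (j - 1)))) * fst (snd (zs ! j)), eta (drop j zs))"
  using assms
proof (induction \<tau> zs arbitrary: j rule: qlist.induct)
  case (2 \<tau> s \<sigma> \<epsilon> zs)
  then show ?case by (cases j) (auto simp: nth_Cons')
qed auto

text \<open>The recursion visits every position, the set only those before the last; there
  \<open>eta []\<close> is \<open>Plus\<close>, so the last position adds no sign.\<close>

lemma qsgn_eq_card:
  "qsgn zs = (-1) ^ card {l. l + 1 < length zs \<and> fst (snd (zs ! l)) = Minus \<and>
     snd (snd (zs ! l)) = Minus \<and> eta (drop (l + 1) zs) = Minus}"
    (is "_ = (-1) ^ card (?S zs)")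
proof (induction zs rule: qsgn.induct)
  case (2 s \<sigma> \<epsilon> zs)
  have fin: "finite (?S zs)" for zs
    by (rule finite_subset[of _ "{..<length zs}"]) auto
  have "?S ((s, \<sigma>, \<epsilon>) # zs) =
    (if \<sigma> = Minus \<and> \<epsilon> = Minus \<and> eta zs = Minus then {0} else {}) \<union> Suc ` ?S zs" (is "?A = ?B")
  proof (rule set_eqI)
    fix l show "l \<in> ?A \<longleftrightarrow> l \<in> ?B"
      by (cases l; cases zs) auto
  qed
  then have "card (?S ((s, \<sigma>, \<epsilon>) # zs)) =
    (if \<sigma> = Minus \<and> \<epsilon> = Minus \<and> eta zs = Minus then 1 else 0) + card (?S zs)"
  proof -
    have "card (Suc ` ?S zs) = card (?S zs)" by (rule card_image) simp
    moreover have "card (insert 0 (Suc ` ?S zs)) = Suc (card (Suc ` ?S zs))"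
      by (rule card_insert_disjoint) (use fin in auto)
    ultimately show "?A = ?B \<Longrightarrow> ?thesis"
      by (simp only: insert_is_Un[symmetric] Un_empty_left split: if_split) simp
  qed
  with 2 show ?case by (simp add: power_add)
qed auto

lemma q_word_eq: "q_word zs = qscale (qsgn zs) (word (unfactor (qlist Plus zs)))"
proof -
  have "map (\<lambda>j. (fst (zs ! j), (if j = 0 then 1 else fst (snd (zs ! (j - 1)))) * fst (snd (zs ! j)),
      \<Prod>n=j..<length zs. snd (snd (zs ! n)))) [0..<length zs] = qlist Plus zs"
    by (rule nth_equalityI) (simp_all add: nth_qlist eta_drop del: One_nat_def)
  then have w: "concat (map (\<lambda>j. zword (fst (zs ! j),
      (if j = 0 then 1 else fst (snd (zs ! (j - 1)))) * fst (snd (zs ! j)),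
      \<Prod>n=j..<length zs. snd (snd (zs ! n)))) [0..<length zs]) = unfactor (qlist Plus zs)"
    unfolding unfactor_def by (metis (no_types, lifting) map_map comp_apply map_cong)
  have "eta (drop (l + 1) zs) = (\<Prod>n=l+1..<length zs. snd (snd (zs ! n)))" if "l + 1 < length zs" for l
    using that by (intro eta_drop) simp
  then have "qsgn zs = (-1) ^ card {l. l + 1 < length zs \<and> fst (snd (zs ! l)) = Minus \<and>
     snd (snd (zs ! l)) = Minus \<and> (\<Prod>n=l+1..<length zs. snd (snd (zs ! n))) = Minus}"
    unfolding qsgn_eq_card by (metis (no_types, lifting))
  with w show ?thesis
    unfolding q_word_def Let_def by simp
qed

lemma eval_q_map:
  assumes "x \<in> A1"
  shows "eval_words (\<lambda>w. msum N (factor w)) (q_map x) = eval_words (wsum N) x"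
  unfolding q_map_def eval_words_extend
proof (rule eval_words_cong)
  fix w assume "w \<in> Poly_Mapping.keys x"
  then have "A1_word w" using assms by (auto simp: A1_def)
  then show "eval_words (\<lambda>w. msum N (factor w)) (q_word (factor w)) = wsum N w"
    using wsum_unfactor[of "factor w" N] by (simp add: q_word_eq unfactor_factor)
qed

lemma eval_p_map: "eval_words (wsum N) (p_map x) = eval_words (\<lambda>w. msum N (factor w)) x"
  unfolding p_map_def eval_words_extend
proof (rule eval_words_cong)
  fix w
  show "eval_words (wsum N) (p_acc 1 (factor w)) = msum N (factor w)"
    by (simp add: p_acc_eq wsum_unfactor flip: of_rat_mult mult.assoc)
qed

text \<open>q translates words into nested sums, the stuffle product multiplies these, and p
  translates back. The translation is termwise in the outermost index, so it respects each cutoff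
  \<open>N\<close>.\<close>

lemma eval_star:
  assumes "x \<in> A1" "y \<in> A1"
  shows "eval_words (wsum N) (x \<star> y) = eval_words (wsum N) x * eval_words (wsum N) y"
proof -
  let ?e = "eval_words (\<lambda>w. msum N (factor w))"
  have "eval_words (wsum N) (x \<star> y) = ?e (stuffle (q_map x) (q_map y))"
    by (simp add: star_def eval_p_map)
  also have "\<dots> = ?e (q_map x) * ?e (q_map y)"
    by (simp add: stuffle_def eval_words_extend2 eval_msum_stuffle_word eval_words_product)
  finally show ?thesis using assms by (simp add: eval_q_map)
qed

section \<open>Admissibility\<close>

fun adm :: "z list \<Rightarrow> bool" where
  "adm [] = True"
| "adm ((s, \<sigma>, \<epsilon>) # zs) \<longleftrightarrow> s > 1 \<or> \<sigma> = Minus"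

lemma admissible_unfactor: "valid zs \<Longrightarrow> admissible (unfactor zs) \<longleftrightarrow> adm zs"
proof (induction zs rule: adm.induct)
  case (2 s \<sigma> \<epsilon> zs)
  have "A1_word (unfactor ((s, \<sigma>, \<epsilon>) # zs))" by (rule A1_unfactor)
  with 2 show ?case
    by (cases "s - 1"; cases \<sigma>; cases \<epsilon>) (auto simp: admissible_def)
qed (simp add: admissible_def A1_word_def)

text \<open>Admissibility depends on the first z alone, and starting from \<open>Plus\<close> leaves
  its s and \<sigma> unchanged.\<close>

lemma adm_qlist [simp]: "adm (qlist Plus zs) \<longleftrightarrow> adm zs"
  by (cases zs rule: adm.cases) auto

lemma adm_plist [simp]: "adm (plist Plus zs) \<longleftrightarrow> adm zs"
  by (cases zs rule: adm.cases) auto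

lemma admissible_zword_append:
  "s \<ge> 1 \<Longrightarrow> A1_word w \<Longrightarrow> s > 1 \<or> \<sigma> = Minus \<Longrightarrow> admissible (zword (s, \<sigma>, \<epsilon>) @ w)"
  by (cases "s - 1") (auto simp: admissible_def A1_word_def split: if_splits)

lemma A1_word_zword_append: "A1_word w \<Longrightarrow> A1_word (zword z @ w)"
  by (cases z) (auto simp: A1_word_def split: if_splits)

lemma stuffle_word_A1: "stuffle_word u v \<in> words_on A1_word"
  by (induction u v rule: stuffle_word.induct)
    (auto intro!: words_on_add words_on_qscale words_on_conc_word A1_word_zword_append
       simp: simp del: zword.simps simp flip: unfactor_def)

text \<open>Every term begins with the first z of \<open>u\<close> or of \<open>v\<close>, or with
  their merger. The merged z has first index s + t \<ge> 2, so it is admissible even when \<sigma>_1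
  \<sigma>_2 = 1; the remainder only has to lie in the span of \<open>A1_word\<close>.\<close>

lemma stuffle_word_admissible:
  assumes "valid u" "valid v" "adm u" "adm v"
  shows "stuffle_word u v \<in> words_on admissible"
  using assms
  by (cases "(u, v)" rule: stuffle_word.cases)
    (auto intro!: words_on_add words_on_qscale admissible_zword_append
       words_on_conc_word[OF stuffle_word_A1]
       simp: admissible_unfactor simp del: zword.simps simp flip: unfactor_def)

lemma A0_words_on: "A0 = words_on admissible"
  by (simp add: A0_def words_on_def)

lemma star_A0:
  assumes "x \<in> A0" "y \<in> A0"
  shows "x \<star> y \<in> A0"
proof -
  have adm: "adm (factor w)" if "admissible w" for w
    using that admissible_unfactor[of "factor w"] by (simp add: admissible_def unfactor_factor)
  have "q_map z \<in> words_on admissible" if "z \<in> A0" for z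
    unfolding q_map_def using that unfolding A0_words_on
    by (rule words_on_extend) (auto simp: q_word_eq intro!: words_on_qscale simp: admissible_unfactor adm)
  then have "stuffle (q_map x) (q_map y) \<in> words_on admissible"
    unfolding stuffle_def using assms
    by (intro words_on_extend2[of _ admissible _ admissible] stuffle_word_admissible) (auto simp: adm)
  then show ?thesis
    unfolding star_def p_map_def A0_words_on
    by (rule words_on_extend) (auto simp: p_acc_eq intro!: words_on_qscale simp: admissible_unfactor adm)
qed

section \<open>Abel's limit theorem\<close>

lemma Abel_limit:
  fixes a :: "nat \<Rightarrow> real"
  assumes "a sums S"
  shows "((\<lambda>x. suminf (\<lambda>n. a n * x ^ n)) \<longlongrightarrow> S) (at_left 1)"
proof -
  \<comment> \<open>Summation by parts: the difference to \<open>S\<close> is \<open>- (1 - x)\<close> times the series of the tails.\<close>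
  define e where "e n = S - (\<Sum>k\<le>n. a k)" for n
  have e0: "e \<longlonglongrightarrow> 0"
    using assms unfolding sums_def_le e_def by (intro tendsto_eq_intros | simp)+
  then obtain B where B: "\<bar>e n\<bar> \<le> B" for n
    using convergent_imp_Bseq[of e] unfolding Bseq_def convergent_def by (metis real_norm_def)
  have sm: "summable (\<lambda>n. \<bar>e n\<bar> * x ^ n)" if "0 < x" "x < 1" for x
  proof (rule summable_comparison_test)
    show "\<exists>N. \<forall>n\<ge>N. norm (\<bar>e n\<bar> * x ^ n) \<le> B * x ^ n"
      using B that by (auto simp: abs_mult intro!: mult_right_mono)
    show "summable (\<lambda>n. B * x ^ n)"
      using that by (intro summable_mult summable_geometric) auto
  qed
  have eq: "suminf (\<lambda>n. a n * x ^ n) - S = - (1 - x) * (suminf (\<lambda>n. e n * x ^ n))" if x: "0 < x" "x < 1" for x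
  proof -
    let ?E = "suminf (\<lambda>n. e n * x ^ n)"
    have E: "(\<lambda>n. e n * x ^ n) sums ?E"
      by (rule summable_sums[OF summable_rabs_cancel]) (use sm[OF x] x in \<open>simp add: abs_mult\<close>)
    \<comment> \<open>With S in the role of e at index -1, \<open>a n\<close> is the difference of e
      at n - 1 and at n. The case distinction is the shifted series of e with S as constant
      term.\<close>
    have "(\<lambda>n. case n of 0 \<Rightarrow> S | Suc m \<Rightarrow> x * (e m * x ^ m)) sums (x * ?E + S)"
      using sums_Suc[of "\<lambda>n. case n of 0 \<Rightarrow> S | Suc m \<Rightarrow> x * (e m * x ^ m)"] sums_mult[OF E, of x]
      by simp
    from sums_diff[OF this E]
    have "(\<lambda>n. (case n of 0 \<Rightarrow> S | Suc m \<Rightarrow> x * (e m * x ^ m)) - e n * x ^ n) sums (x * ?E + S - ?E)" .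
    moreover have "(case n of 0 \<Rightarrow> S | Suc m \<Rightarrow> x * (e m * x ^ m)) - e n * x ^ n = a n * x ^ n" for n
      by (cases n) (simp_all add: e_def algebra_simps)
    ultimately show ?thesis by (simp add: sums_iff algebra_simps)
  qed
  have "((\<lambda>x. suminf (\<lambda>n. a n * x ^ n) - S) \<longlongrightarrow> 0) (at_left 1)"
  proof (rule tendstoI)
    fix r :: real assume r: "0 < r"
    \<comment> \<open>The factor 1 - x makes the head, bounded by \<open>C\<close> below, small near
      1 and cancels the 1/(1 - x) of the geometric bound on the tail; each gets half of r.\<close>
    obtain N where N: "\<bar>e n\<bar> < r / 2" if "n \<ge> N" for n
      using LIMSEQ_D[OF e0, of "r / 2"] r by auto
    define C where "C = (\<Sum>n<N. \<bar>e n\<bar>)"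
    have "((\<lambda>x. (1 - x) * C) \<longlongrightarrow> (1 - 1) * C) (at_left (1::real))"
      by (intro tendsto_intros)
    then have "\<forall>\<^sub>F x in at_left 1. (1 - x) * C < r / 2"
      using r by (intro order_tendstoD(2)[of _ 0]) auto
    moreover have "\<forall>\<^sub>F x in at_left (1::real). x \<in> {0<..<1}"
      by (intro eventually_at_leftI[of 0]) auto
    ultimately show "\<forall>\<^sub>F x in at_left 1. dist (suminf (\<lambda>n. a n * x ^ n) - S) 0 < r"
    proof eventually_elim
      case (elim x)
      then have x: "0 < x" "x < 1" by auto
      have "\<bar>suminf (\<lambda>n. e n * x ^ n)\<bar> \<le> (suminf (\<lambda>n. \<bar>e n\<bar> * x ^ n))"
        using summable_rabs[of "\<lambda>n. e n * x ^ n"] sm[OF x] x by (simp add: abs_mult)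
      also have "\<dots> = (suminf (\<lambda>n. \<bar>e (n + N)\<bar> * x ^ (n + N))) + (\<Sum>n<N. \<bar>e n\<bar> * x ^ n)"
        by (rule suminf_split_initial_segment[OF sm[OF x]])
      also have "(\<Sum>n<N. \<bar>e n\<bar> * x ^ n) \<le> C"
        unfolding C_def using x by (intro sum_mono mult_left_le power_le_one) auto
      also have "(suminf (\<lambda>n. \<bar>e (n + N)\<bar> * x ^ (n + N))) \<le> (suminf (\<lambda>n. r / 2 * x ^ n))"
      proof (rule suminf_le)
        show "\<bar>e (n + N)\<bar> * x ^ (n + N) \<le> r / 2 * x ^ n" for n
          using N[of "n + N"] x by (intro mult_mono power_decreasing) auto
        show "summable (\<lambda>n. \<bar>e (n + N)\<bar> * x ^ (n + N))"
          using summable_ignore_initial_segment[OF sm[OF x], of N] .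
        show "summable (\<lambda>n. r / 2 * x ^ n)"
          using x by (intro summable_mult summable_geometric) auto
      qed
      also have "\<dots> = r / 2 / (1 - x)"
        using x by (subst suminf_mult) (auto simp: suminf_geometric summable_geometric)
      finally have "(1 - x) * \<bar>suminf (\<lambda>n. e n * x ^ n)\<bar> \<le> (1 - x) * (r / 2 / (1 - x) + C)"
        using x by (intro mult_left_mono) auto
      also have "\<dots> = r / 2 + (1 - x) * C"
        unfolding distrib_left
        by (subst times_divide_eq_right, subst nonzero_mult_div_cancel_left) (use x in auto)
      also have "\<dots> < r" using elim by simp
      finally show ?case using x by (simp add: eq abs_mult)
    qed
  qed
  then show ?thesis by (rule LIM_zero_cancel)
qed

section \<open>Growth of the coefficients and convergence\<close>

lemma form_coeff_bound: "\<bar>form_coeff \<sigma> \<epsilon> n\<bar> \<le> 2"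
  by (cases \<sigma>) (auto simp: form_coeff_def chi_def power_abs abs_mult)

lemma form_coeff_0 [simp]: "form_coeff \<sigma> \<epsilon> 0 = 0"
  by (simp add: form_coeff_def)

lemma form_coeff_add_2: "n > 0 \<Longrightarrow> form_coeff \<sigma> \<epsilon> (n + 2) = sgn_of \<sigma> * form_coeff \<sigma> \<epsilon> n"
  by (simp add: form_coeff_def chi_def parity_sign_def)

lemma wcoeff_0: "w \<noteq> [] \<Longrightarrow> wcoeff w 0 = 0"
proof (cases w)
  case (Cons a v)
  then show ?thesis by (cases a) auto
qed simp

lemma A1_word_Cons: "A1_word (a # w) \<longleftrightarrow> A1_word w \<and> (a = Omega0 \<longrightarrow> w \<noteq> [])"
  by (auto simp: A1_word_def)

lemma harm_ge_1: "n \<ge> 1 \<Longrightarrow> harm n \<ge> (1::real)"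
  using harm_mono[of 1 n, where ?'a = real] by (simp add: harm_def)

text \<open>Each letter other than \<open>Omega0\<close> adds one summation against 1/m, hence one
  factor \<open>2 * harm n\<close>, the 2 being the bound on \<open>form_coeff\<close>.\<close>

lemma wcoeff_growth:
  assumes "A1_word w" "n \<ge> 1"
  shows "real n * \<bar>wcoeff w n\<bar> \<le> (2 * harm n) ^ length w"
  using assms
proof (induction w arbitrary: n)
  case (Cons a w)
  have H: "1 \<le> 2 * (harm n :: real)" "0 \<le> (harm n :: real)"
    using harm_ge_1[OF Cons.prems(2)] by auto
  have A1: "A1_word w" using Cons.prems by (simp add: A1_word_Cons)
  show ?case
  proof (cases a)
    case Omega0
    have "real n * \<bar>wcoeff (a # w) n\<bar> = 1 * \<bar>wcoeff w n\<bar>"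
      using Cons.prems by (simp add: Omega0)
    also have "\<dots> \<le> real n * \<bar>wcoeff w n\<bar>"
      using Cons.prems by (intro mult_right_mono) auto
    also have "\<dots> \<le> (2 * harm n) ^ length w"
      using Cons A1 by auto
    also have "\<dots> \<le> (2 * harm n) ^ length (a # w)"
      using H by (intro power_increasing) auto
    finally show ?thesis .
  next
    case (Omega \<sigma> \<epsilon>)
    have "real n * \<bar>wcoeff (a # w) n\<bar> = \<bar>\<Sum>m<n. form_coeff \<sigma> \<epsilon> (n - m) * wcoeff w m\<bar>"
      using Cons.prems by (simp add: Omega)
    also have "\<dots> \<le> (\<Sum>m<n. 2 * \<bar>wcoeff w m\<bar>)"
      by (intro order.trans[OF sum_abs] sum_mono) (auto simp: abs_mult form_coeff_bound intro!: mult_right_mono)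
    also have "\<dots> \<le> (2 * harm n) ^ length (a # w)"
    proof (cases "w = []")
      \<comment> \<open>The coefficients of the empty word sit at m = 0, where no bound by 1/m is
        available; their sum is 1.\<close>
      case True
      have "(\<Sum>m<n. 2 * \<bar>wcoeff w m\<bar>) \<le> (2::real)"
        by (simp add: True of_bool_def sum.delta' flip: sum_distrib_left)
      also have "\<dots> \<le> 2 * harm n" using harm_ge_1[OF Cons.prems(2)] by auto
      finally show ?thesis by (simp add: True)
    next
      case False
      have "(\<Sum>m<n. 2 * \<bar>wcoeff w m\<bar>) = (\<Sum>m\<in>{1..<n}. 2 * \<bar>wcoeff w m\<bar>)"
        using wcoeff_0[OF False] by (intro sum.mono_neutral_right) (auto simp: not_less_eq_eq)
      also have "\<dots> \<le> (\<Sum>m\<in>{1..<n}. 2 * ((2 * harm n) ^ length w * inverse (real m)))"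
      proof (intro sum_mono mult_left_mono)
        fix m assume m: "m \<in> {1..<n}"
        then have "real m * \<bar>wcoeff w m\<bar> \<le> (2 * harm m) ^ length w"
          using Cons.IH A1 by auto
        also have "\<dots> \<le> (2 * harm n) ^ length w"
          using m harm_mono[of m n, where ?'a = real] by (intro power_mono) (auto simp: harm_nonneg)
        finally show "\<bar>wcoeff w m\<bar> \<le> (2 * harm n) ^ length w * inverse (real m)"
          using m by (simp add: field_simps)
      qed auto
      also have "\<dots> = 2 * (2 * harm n) ^ length w * (\<Sum>m\<in>{1..<n}. inverse (real m))"
        by (simp add: sum_distrib_left mult.assoc)
      also have "\<dots> \<le> 2 * (2 * harm n) ^ length w * harm n"
      proof (rule mult_left_mono)
        show "(\<Sum>m\<in>{1..<n}. inverse (real m)) \<le> harm n"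
          unfolding harm_def by (intro sum_mono2) auto
      qed (use H in auto)
      finally show ?thesis by (simp add: mult_ac)
    qed
    finally show ?thesis .
  qed
qed auto

text \<open>Harmonic numbers grow like log n, so their powers stay below any positive power of n.
  The exponent 1/2 leaves n^(-3/2) after division by n^2 and n^(-1/2) after division by n.\<close>

lemma harm_power_bound: "\<exists>C. \<forall>n\<ge>1. (2 * harm n) ^ k \<le> C * sqrt (real n)"
proof -
  \<comment> \<open>Chosen for a k \<le> 1/2, with k + 1 keeping it positive at k = 0. The constant
    2 + 2/a below comes from H_n \<le> 1 + ln n \<le> (1 + 1/a) n^a.\<close>
  define a where "a = 1 / (2 * real (k + 1))"
  have a: "0 < a" "a * real k \<le> 1 / 2" by (auto simp: a_def field_simps)
  have "(2 * harm n) ^ k \<le> (2 + 2 / a) ^ k * sqrt (real n)" if n: "n \<ge> 1" for n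
  proof -
    have "harm n - ln (real n) \<le> harm (Suc 0) - ln (real (Suc 0))"
      using decseqD[OF decseq_harm_diff_ln, of 0 "n - 1"] n by simp
    then have "harm n \<le> 1 + ln (real n)" by (simp add: harm_def)
    also have "\<dots> \<le> 1 * (real n powr a) + real n powr a / a"
      using ln_powr_bound[of "real n" a] ge_one_powr_ge_zero[of "real n" a] n a by auto
    finally have "2 * harm n \<le> (2 + 2 / a) * real n powr a" by (simp add: algebra_simps)
    then have "(2 * harm n) ^ k \<le> ((2 + 2 / a) * real n powr a) ^ k"
      by (intro power_mono) (auto simp: harm_nonneg)
    also have "\<dots> = (2 + 2 / a) ^ k * real n powr (a * real k)"
      using n by (simp add: power_mult_distrib powr_power mult.commute)
    also have "\<dots> \<le> (2 + 2 / a) ^ k * real n powr (1 / 2)"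
      using n a by (intro mult_left_mono powr_mono) auto
    finally show ?thesis by (simp add: powr_half_sqrt)
  qed
  then show ?thesis by blast
qed

lemma summable_harm_power: "summable (\<lambda>n. (2 * harm n) ^ k / (real n)\<^sup>2)"
proof -
  obtain C where C: "\<And>n. n \<ge> 1 \<Longrightarrow> (2 * harm n) ^ k \<le> C * sqrt (real n)"
    using harm_power_bound by blast
  show ?thesis
  proof (rule summable_comparison_test)
    show "summable (\<lambda>n. C * real n powr (- 3 / 2))"
      by (intro summable_mult) (simp add: summable_real_powr_iff)
    show "\<exists>N. \<forall>n\<ge>N. norm ((2 * harm n) ^ k / (real n)\<^sup>2) \<le> C * real n powr (- 3 / 2)"
    proof (intro exI allI impI)
      fix n :: nat assume n: "n \<ge> 1"
      have "C * sqrt (real n) / (real n)\<^sup>2 = C * (real n powr (1 / 2) / real n powr 2)"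
        using n by (simp add: powr_half_sqrt powr_numeral)
      also have "\<dots> = C * real n powr (- 3 / 2)"
        using n by (subst powr_diff[symmetric]) auto
      finally show "norm ((2 * harm n) ^ k / (real n)\<^sup>2) \<le> C * real n powr (- 3 / 2)"
        using divide_right_mono[OF C[OF n], of "(real n)\<^sup>2"] by (simp add: harm_nonneg)
    qed
  qed
qed

lemma harm_power_tendsto: "(\<lambda>n. (2 * harm n) ^ k / real n) \<longlonglongrightarrow> 0"
proof -
  obtain C where C: "\<And>n. n \<ge> 1 \<Longrightarrow> (2 * harm n) ^ k \<le> C * sqrt (real n)"
    using harm_power_bound by blast
  show ?thesis
  proof (rule tendsto_sandwich)
    show "(\<lambda>n. 0) \<longlonglongrightarrow> (0::real)" by simp
    have "(\<lambda>n. real n powr (- 1 / 2)) \<longlonglongrightarrow> 0"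
      by (rule tendsto_neg_powr) (auto simp: filterlim_real_sequentially)
    from tendsto_mult_right_zero[OF this]
    show "(\<lambda>n. C * real n powr (- 1 / 2)) \<longlonglongrightarrow> 0" .
    show "\<forall>\<^sub>F n in sequentially. (2 * harm n) ^ k / real n \<le> C * real n powr (- 1 / 2)"
      using eventually_ge_at_top[of 1]
    proof eventually_elim
      case (elim n)
      have "C * sqrt (real n) / real n = C * (real n powr (1 / 2) / real n powr 1)"
        using elim by (simp add: powr_half_sqrt)
      also have "\<dots> = C * real n powr (- 1 / 2)"
        using elim by (subst powr_diff[symmetric]) auto
      finally show ?case using divide_right_mono[OF C[OF elim], of "real n"] by simp
    qed
    show "\<forall>\<^sub>F n in sequentially. 0 \<le> (2 * harm n) ^ k / real n"
      by (simp add: harm_nonneg)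
  qed
qed

text \<open>Applied to words beginning with \<open>Omega Minus _\<close>, whose coefficients nearly cancel at distance 2
  because \<open>form_coeff Minus \<epsilon> (n + 2) = - form_coeff Minus \<epsilon> n\<close>.\<close>

lemma summable_if_pair_sums:
  fixes f :: "nat \<Rightarrow> real"
  assumes "summable (\<lambda>n. f (n + 2) + f n)" "f \<longlonglongrightarrow> 0"
  shows "summable f"
proof -
  have "(\<Sum>n<N. f (n + 2) + f n) = 2 * (\<Sum>n<N. f n) + f N + f (Suc N) - f 0 - f 1" for N
    by (induction N) auto
  then have "(\<Sum>n<N. f n) = ((\<Sum>n<N. f (n + 2) + f n) - f N - f (Suc N) + f 0 + f 1) / 2" for N
    by (simp add: algebra_simps)
  moreover have "(\<lambda>N. ((\<Sum>n<N. f (n + 2) + f n) - f N - f (Suc N) + f 0 + f 1) / 2)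
      \<longlonglongrightarrow> ((suminf (\<lambda>n. f (n + 2) + f n)) - 0 - 0 + f 0 + f 1) / 2"
    using summable_LIMSEQ[OF assms(1)] assms(2) LIMSEQ_Suc[OF assms(2)]
    by (intro tendsto_intros) auto
  ultimately show ?thesis unfolding summable_def sums_def by (simp only:) blast
qed

lemma summable_wcoeff:
  assumes "admissible w"
  shows "summable (wcoeff w)"
proof (cases w)
  case Nil
  then show ?thesis by (auto intro: summable_finite[of "{0}"])
next
  case (Cons a w')
  have A1: "A1_word w'" "A1_word w" using assms by (auto simp: admissible_def Cons A1_word_Cons)
  define k where "k = length w'"
  define G where "G j n = (2 * harm n) ^ j / (real n)\<^sup>2" for j n
  have G: "summable (G j)" for j unfolding G_def by (rule summable_harm_power)
  have gr: "\<bar>wcoeff w' n\<bar> / real n \<le> G k n" "\<bar>wcoeff w n\<bar> / real n \<le> G (Suc k) n" if "n \<ge> 1" for n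
    using wcoeff_growth[OF A1(1) that] wcoeff_growth[OF A1(2) that] that
    by (auto simp: G_def k_def Cons field_simps power2_eq_square)
  show ?thesis
  proof (cases a)
    case Omega0
    have "\<bar>wcoeff w n\<bar> \<le> G k n" if "n \<ge> 1" for n
      using gr(1)[OF that] by (simp add: Cons Omega0)
    then show ?thesis by (intro summable_comparison_test'[OF G[of k], of 1]) auto
  next
    case (Omega \<sigma> \<epsilon>)
    then have [simp]: "\<sigma> = Minus" using assms by (cases \<sigma>; cases \<epsilon>) (auto simp: admissible_def Cons)
    let ?a = "wcoeff w'" and ?c = "form_coeff \<sigma> \<epsilon>"
    define b where "b n = (\<Sum>m<n. ?c (n - m) * ?a m)" for n
    have w: "wcoeff w n = b n / real n" for n by (simp add: Cons Omega b_def)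
    \<comment> \<open>A shift by 2 reverses the sign of all old gaps; the new gaps 2 and 1 give the
      two extra terms.\<close>
    have rec: "b (n + 2) = - b n + ?c 2 * ?a n + ?c 1 * ?a (n + 1)" for n
    proof -
      have "(\<Sum>m<n. ?c (n + 2 - m) * ?a m) = - b n"
        unfolding b_def sum_negf[symmetric]
      proof (rule sum.cong[OF refl])
        fix m assume "m \<in> {..<n}"
        then show "?c (n + 2 - m) * ?a m = - (?c (n - m) * ?a m)"
          using form_coeff_add_2[of "n - m" \<sigma> \<epsilon>] by (simp add: Suc_diff_le)
      qed
      then show ?thesis by (simp add: b_def numeral_2_eq_2)
    qed
    have bnd: "\<bar>wcoeff w (n + 2) + wcoeff w n\<bar> \<le> 2 * G k n + 2 * G k (n + 1) + 2 * G (Suc k) n"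
      if n: "n \<ge> 1" for n
    proof -
      \<comment> \<open>The \<open>b n\<close> cancel only over a common denominator: replacing 1/n
        by 1/(n + 2) costs 2/(n (n + 2)), hence the last summand. All that remains is a power of log
        n over n^2.\<close>
      have "wcoeff w (n + 2) + wcoeff w n =
        ?c 2 * (?a n / (real n + 2)) + ?c 1 * (?a (n + 1) / (real n + 2)) + 2 * (wcoeff w n / (real n + 2))"
      proof -
        have "wcoeff w (n + 2) = (- b n + ?c 2 * ?a n + ?c 1 * ?a (n + 1)) / (real n + 2)"
          unfolding w rec by simp
        moreover have "wcoeff w n = b n / (real n + 2) + 2 * (wcoeff w n / (real n + 2))"
        proof -
          have "b n = real n * wcoeff w n" using n by (simp add: w)
          then have "b n / (real n + 2) + 2 * (wcoeff w n / (real n + 2)) =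
              (real n + 2) * wcoeff w n / (real n + 2)"
            by (simp add: distrib_right add_divide_distrib)
          also have "\<dots> = wcoeff w n" by (rule nonzero_mult_div_cancel_left) simp
          finally show ?thesis ..
        qed
        ultimately show ?thesis by (simp add: add_divide_distrib diff_divide_distrib)
      qed
      also have "\<bar>\<dots>\<bar> \<le> \<bar>?c 2\<bar> * (\<bar>?a n\<bar> / (real n + 2)) + \<bar>?c 1\<bar> * (\<bar>?a (n + 1)\<bar> / (real n + 2)) +
          2 * (\<bar>wcoeff w n\<bar> / (real n + 2))"
        by (intro order.trans[OF abs_triangle_ineq] add_mono) (auto simp: abs_mult)
      also have "\<dots> \<le> 2 * G k n + 2 * G k (n + 1) + 2 * G (Suc k) n"
      proof (intro add_mono mult_mono form_coeff_bound order.refl)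
        have "\<bar>?a n\<bar> / (real n + 2) \<le> \<bar>?a n\<bar> / real n"
          using n by (intro divide_left_mono) auto
        also note gr(1)[OF n]
        finally show "\<bar>?a n\<bar> / (real n + 2) \<le> G k n" .
        have "\<bar>?a (n + 1)\<bar> / (real n + 2) \<le> \<bar>?a (n + 1)\<bar> / real (n + 1)"
          using n by (intro divide_left_mono) auto
        also have "\<dots> \<le> G k (n + 1)" by (rule gr) simp
        finally show "\<bar>?a (n + 1)\<bar> / (real n + 2) \<le> G k (n + 1)" .
        have "\<bar>wcoeff w n\<bar> / (real n + 2) \<le> \<bar>wcoeff w n\<bar> / real n"
          using n by (intro divide_left_mono) auto
        also note gr(2)[OF n]
        finally show "\<bar>wcoeff w n\<bar> / (real n + 2) \<le> G (Suc k) n" .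
      qed auto
      finally show ?thesis .
    qed
    show ?thesis
    proof (rule summable_if_pair_sums)
      have "summable (\<lambda>n. 2 * G k n + 2 * G k (n + 1) + 2 * G (Suc k) n)"
        using G summable_ignore_initial_segment[OF G, of k 1] by (intro summable_add summable_mult) auto
      then show "summable (\<lambda>n. wcoeff w (n + 2) + wcoeff w n)"
        by (rule summable_comparison_test'[where N = 1]) (use bnd in auto)
      have "\<forall>\<^sub>F n in sequentially. norm (wcoeff w n) \<le> (2 * harm n) ^ length w / real n"
        using eventually_ge_at_top[of 1]
        by eventually_elim (use wcoeff_growth[OF A1(2)] in \<open>auto simp: field_simps\<close>)
      then show "wcoeff w \<longlonglongrightarrow> 0"
        using harm_power_tendsto by (rule Lim_null_comparison)
    qed
  qed
qed

section \<open>Power series\<close>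

definition wfun :: "letter list \<Rightarrow> real \<Rightarrow> real" where
  "wfun w x = suminf (\<lambda>n. wcoeff w n * x ^ n)"

lemma summable_form_coeff:
  fixes x :: real
  assumes "\<bar>x\<bar> < 1"
  shows "summable (\<lambda>n. \<bar>form_coeff \<sigma> \<epsilon> n\<bar> * \<bar>x\<bar> ^ n)"
proof (rule summable_comparison_test')
  show "summable (\<lambda>n. 2 * \<bar>x\<bar> ^ n)"
    using assms by (intro summable_mult summable_geometric) auto
  show "norm (\<bar>form_coeff \<sigma> \<epsilon> n\<bar> * \<bar>x\<bar> ^ n) \<le> 2 * \<bar>x\<bar> ^ n" if "n \<ge> 0" for n
    using form_coeff_bound[of \<sigma> \<epsilon> n] by (auto simp: abs_mult power_abs intro!: mult_right_mono)
qed

text \<open>As \<open>form_coeff\<close> vanishes at 0, the index m = n may be included, which makes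
  the sum a coefficient of a Cauchy product.\<close>

lemma wcoeff_Omega_atMost:
  "real n * wcoeff (Omega \<sigma> \<epsilon> # w) n = (\<Sum>m\<le>n. wcoeff w m * form_coeff \<sigma> \<epsilon> (n - m))"
proof (cases "n = 0")
  case False
  have "(\<Sum>m\<le>n. wcoeff w m * form_coeff \<sigma> \<epsilon> (n - m)) = (\<Sum>m<n. wcoeff w m * form_coeff \<sigma> \<epsilon> (n - m))"
    by (simp flip: lessThan_Suc_atMost)
  with False show ?thesis by (simp add: mult.commute)
qed simp

text \<open>Absolute convergence is what Cauchy products require. Dropping the division by n leaves
  as majorant the series of the tail, or its Cauchy product with the series of the form.\<close>

lemma summable_wcoeff_power_abs:
  fixes x :: real
  assumes "\<bar>x\<bar> < 1"
  shows "summable (\<lambda>n. \<bar>wcoeff w n\<bar> * \<bar>x\<bar> ^ n)"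
proof (induction w)
  case Nil
  show ?case by (rule summable_finite[of "{0}"]) auto
next
  case (Cons a w)
  show ?case
  proof (cases a)
    case Omega0
    show ?thesis
    proof (rule summable_comparison_test'[OF Cons, where N = 1])
      fix n :: nat assume n: "n \<ge> 1"
      then have "\<bar>wcoeff w n\<bar> / real n \<le> \<bar>wcoeff w n\<bar> / 1"
        by (intro divide_left_mono) auto
      then have "\<bar>wcoeff w n\<bar> / real n * \<bar>x\<bar> ^ n \<le> \<bar>wcoeff w n\<bar> / 1 * \<bar>x\<bar> ^ n"
        by (rule mult_right_mono) simp
      then show "norm (\<bar>wcoeff (a # w) n\<bar> * \<bar>x\<bar> ^ n) \<le> \<bar>wcoeff w n\<bar> * \<bar>x\<bar> ^ n"
        by (simp add: Omega0 abs_mult power_abs)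
    qed
  next
    case (Omega \<sigma> \<epsilon>)
    let ?b = "\<lambda>n. \<Sum>m\<le>n. (\<bar>wcoeff w m\<bar> * \<bar>x\<bar> ^ m) * (\<bar>form_coeff \<sigma> \<epsilon> (n - m)\<bar> * \<bar>x\<bar> ^ (n - m))"
    have "summable ?b"
      by (rule summable_Cauchy_product)
        (use Cons summable_form_coeff[OF assms, of \<sigma> \<epsilon>] in \<open>auto simp: abs_mult power_abs\<close>)
    then show ?thesis
    proof (rule summable_comparison_test'[where N = 1])
      fix n :: nat assume n: "n \<ge> 1"
      have "\<bar>wcoeff (a # w) n\<bar> \<le> real n * \<bar>wcoeff (a # w) n\<bar>"
        using n mult_right_mono[of 1 "real n" "\<bar>wcoeff (a # w) n\<bar>"] by simp
      also have "\<dots> = \<bar>\<Sum>m\<le>n. wcoeff w m * form_coeff \<sigma> \<epsilon> (n - m)\<bar>"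
        using arg_cong[OF wcoeff_Omega_atMost[of n \<sigma> \<epsilon> w], of abs] by (simp only: Omega abs_mult abs_of_nat)
      also have "\<dots> \<le> (\<Sum>m\<le>n. \<bar>wcoeff w m\<bar> * \<bar>form_coeff \<sigma> \<epsilon> (n - m)\<bar>)"
        by (rule order.trans[OF sum_abs]) (simp add: abs_mult)
      finally have "\<bar>wcoeff (a # w) n\<bar> * \<bar>x\<bar> ^ n \<le>
          (\<Sum>m\<le>n. \<bar>wcoeff w m\<bar> * \<bar>form_coeff \<sigma> \<epsilon> (n - m)\<bar>) * \<bar>x\<bar> ^ n"
        by (rule mult_right_mono) simp
      also have "\<dots> = ?b n"
        unfolding sum_distrib_right
      proof (rule sum.cong[OF refl])
        fix m assume "m \<in> {..n}"
        then have "\<bar>x\<bar> ^ n = \<bar>x\<bar> ^ m * \<bar>x\<bar> ^ (n - m)" by (simp flip: power_add)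
        then show "\<bar>wcoeff w m\<bar> * \<bar>form_coeff \<sigma> \<epsilon> (n - m)\<bar> * \<bar>x\<bar> ^ n =
          (\<bar>wcoeff w m\<bar> * \<bar>x\<bar> ^ m) * (\<bar>form_coeff \<sigma> \<epsilon> (n - m)\<bar> * \<bar>x\<bar> ^ (n - m))"
          by (simp only: mult_ac)
      qed
      finally show "norm (\<bar>wcoeff (a # w) n\<bar> * \<bar>x\<bar> ^ n) \<le> ?b n"
        by (simp add: abs_mult power_abs)
    qed
  qed
qed

lemma summable_wcoeff_power: "\<bar>x\<bar> < 1 \<Longrightarrow> summable (\<lambda>n. wcoeff w n * x ^ n)"
  using summable_wcoeff_power_abs[of x w]
  by (intro summable_rabs_cancel[of "\<lambda>n. wcoeff w n * x ^ n"]) (simp add: abs_mult power_abs)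

lemma form_coeff_sums:
  fixes x :: real
  assumes "0 < x" "x < 1"
  shows "suminf (\<lambda>n. form_coeff \<sigma> \<epsilon> n * x ^ n) = x * form (Omega \<sigma> \<epsilon>) x"
proof -
  let ?f = "\<lambda>n. form_coeff \<sigma> \<epsilon> n * x ^ n"
  define S where "S = suminf ?f"
  have sm: "summable ?f"
    using summable_form_coeff[of x \<sigma> \<epsilon>] assms
    by (intro summable_rabs_cancel[of ?f]) (simp add: abs_mult power_abs)
  have sm1: "summable (\<lambda>n. ?f (Suc n))" using sm by (subst summable_Suc_iff)
  \<comment> \<open>The recurrence at distance 2 starts at index 1, since \<open>form_coeff\<close>
    is 0 at index 0; the first index it reaches is therefore 3.\<close>
  have "suminf (\<lambda>n. ?f (n + 3)) = suminf (\<lambda>n. sgn_of \<sigma> * x\<^sup>2 * ?f (Suc n))"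
    using form_coeff_add_2[of "Suc _" \<sigma> \<epsilon>]
    by (intro arg_cong[of _ _ suminf] ext) (simp add: numeral_eq_Suc algebra_simps)
  also have "\<dots> = sgn_of \<sigma> * x\<^sup>2 * (S - ?f 0)"
    using suminf_mult[OF sm1] suminf_split_head[OF sm] by (simp add: S_def)
  finally have "S = sgn_of \<sigma> * x\<^sup>2 * S + form_coeff \<sigma> \<epsilon> 1 * x + form_coeff \<sigma> \<epsilon> 2 * x\<^sup>2"
    using suminf_split_initial_segment[OF sm, of 3] by (simp add: S_def numeral_3_eq_3 numeral_2_eq_2)
  moreover have "form_coeff \<sigma> \<epsilon> 1 = (if \<epsilon> = Minus then 2 * sgn_of \<sigma> else 0)"
    "form_coeff \<sigma> \<epsilon> 2 = (if \<epsilon> = Plus then 2 * sgn_of \<sigma> else 0)"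
    by (cases \<epsilon>; simp add: form_coeff_def parity_sign_def chi_def)+
  moreover have "x\<^sup>2 < 1" using assms by (simp add: power_less_one_iff)
  moreover have "0 < 1 + x\<^sup>2" by (simp add: add_pos_nonneg)
  ultimately show ?thesis
    unfolding S_def[symmetric]
    by (cases \<sigma>; cases \<epsilon>) (simp_all add: field_simps power2_eq_square)
qed

text \<open>Multiplied by x, the derivative has coefficients n c_n. This removes the division by n
  in \<open>wcoeff\<close> and leaves the series of x \<open>form a x\<close> times that of
  \<open>wfun w\<close>.\<close>

lemma wfun_deriv:
  fixes x :: real
  assumes x: "0 < x" "x < 1" and w: "A1_word (a # w)"
  shows "(wfun (a # w) has_real_derivative form a x * wfun w x) (at x)"
proof -
  let ?c = "wcoeff (a # w)"
  have D: "(wfun (a # w) has_real_derivative suminf (\<lambda>n. diffs ?c n * x ^ n)) (at x)"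
    unfolding wfun_def using x
    by (intro termdiffs_strong'[where K = 1] summable_wcoeff_power) auto
  have sd: "summable (\<lambda>n. diffs ?c n * x ^ n)"
    using x by (intro termdiff_converges[where K = 1] summable_wcoeff_power) auto
  have "(\<lambda>n. diffs ?c n * x ^ n * x) sums (suminf (\<lambda>n. diffs ?c n * x ^ n) * x)"
    by (intro sums_mult2 summable_sums sd)
  then have "(\<lambda>n. real n * ?c n * x ^ n) sums (suminf (\<lambda>n. diffs ?c n * x ^ n) * x)"
    using sums_Suc[of "\<lambda>n. real n * ?c n * x ^ n"] by (simp add: diffs_def mult_ac)
  moreover have "suminf (\<lambda>n. real n * ?c n * x ^ n) = x * form a x * wfun w x"
  proof (cases a)
    case Omega0
    \<comment> \<open>At n = 0 the factor n gives 0, so the coefficient of \<open>w\<close> must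
      vanish there; \<open>w\<close> is nonempty because the word does not end in
      \<open>Omega0\<close>.\<close>
    have "wcoeff w 0 = 0" using w by (auto simp: Omega0 A1_word_Cons intro: wcoeff_0)
    then have "real n * ?c n = wcoeff w n" for n
      by (cases "n = 0") (auto simp: Omega0)
    then show ?thesis using x by (simp add: wfun_def Omega0)
  next
    case (Omega \<sigma> \<epsilon>)
    have "wfun w x * (x * form a x) = suminf (\<lambda>k. \<Sum>i\<le>k. (wcoeff w i * x ^ i) * (form_coeff \<sigma> \<epsilon> (k - i) * x ^ (k - i)))"
      unfolding wfun_def Omega form_coeff_sums[OF x, symmetric]
      by (rule Cauchy_product)
        (use x summable_wcoeff_power_abs[of x w] summable_form_coeff[of x \<sigma> \<epsilon>] in \<open>auto simp: abs_mult power_abs\<close>)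
    moreover have "(\<Sum>i\<le>k. (wcoeff w i * x ^ i) * (form_coeff \<sigma> \<epsilon> (k - i) * x ^ (k - i))) = real k * ?c k * x ^ k" for k
      unfolding Omega wcoeff_Omega_atMost sum_distrib_right
    proof (rule sum.cong[OF refl])
      fix m assume "m \<in> {..k}"
      then have "x ^ k = x ^ m * x ^ (k - m)" by (simp flip: power_add)
      then show "(wcoeff w m * x ^ m) * (form_coeff \<sigma> \<epsilon> (k - m) * x ^ (k - m)) =
        wcoeff w m * form_coeff \<sigma> \<epsilon> (k - m) * x ^ k"
        by (simp only: mult_ac)
    qed
    ultimately show ?thesis by (simp only: mult_ac)
  qed
  ultimately have "suminf (\<lambda>n. diffs ?c n * x ^ n) * x = form a x * wfun w x * x"
    by (simp add: sums_iff mult_ac)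
  then show ?thesis using D x by simp
qed

lemma isCont_wfun: "\<bar>x\<bar> < 1 \<Longrightarrow> isCont (wfun w) x"
  unfolding wfun_def
  by (rule DERIV_isCont, rule termdiffs_strong'[where K = 1]) (auto intro: summable_wcoeff_power)

lemma wfun_0: "w \<noteq> [] \<Longrightarrow> wfun w 0 = 0"
  unfolding wfun_def by (subst powser_zero) (rule wcoeff_0)

lemma wfun_Nil [simp]: "wfun [] x = 1"
  unfolding wfun_def by (subst suminf_finite[of "{0}"]) auto

section \<open>Iterated integrals\<close>

fun form_sgn :: "letter \<Rightarrow> real" where
  "form_sgn Omega0 = 1" | "form_sgn (Omega \<sigma> \<epsilon>) = sgn_of \<sigma>"

lemma form_fun:
  "form Omega0 = (\<lambda>t. 1 / t)"
  "form (Omega Plus Minus) = (\<lambda>t. 2 / (1 - t\<^sup>2))"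
  "form (Omega Minus Minus) = (\<lambda>t. - 2 / (1 + t\<^sup>2))"
  "form (Omega Plus Plus) = (\<lambda>t. 2 * t / (1 - t\<^sup>2))"
  "form (Omega Minus Plus) = (\<lambda>t. - 2 * t / (1 + t\<^sup>2))"
  by (auto simp: fun_eq_iff)

lemma one_minus_square_pos: "0 < t \<Longrightarrow> t < 1 \<Longrightarrow> 0 < 1 - (t::real)\<^sup>2"
  by (simp add: power_less_one_iff)

lemma one_plus_square_pos: "0 < 1 + (t::real)\<^sup>2"
  by (simp add: add_pos_nonneg)

lemma letter_cases [case_names Omega0 PlusMinus MinusMinus PlusPlus MinusPlus]:
  assumes "a = Omega0 \<Longrightarrow> P" "a = Omega Plus Minus \<Longrightarrow> P" "a = Omega Minus Minus \<Longrightarrow> P"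
    "a = Omega Plus Plus \<Longrightarrow> P" "a = Omega Minus Plus \<Longrightarrow> P"
  shows P
  using assms by (metis letter.exhaust sign.exhaust)

lemma abs_form:
  assumes "0 < t" "t < 1"
  shows "\<bar>form a t\<bar> = form_sgn a * form a t"
  using one_minus_square_pos[OF assms] one_plus_square_pos[of t] assms
  by (cases a rule: letter_cases) (simp_all add: abs_mult)

lemma form_sgn_square [simp]: "form_sgn a * form_sgn a = 1"
  by (cases a rule: letter_cases) auto

lemma isCont_form:
  assumes "0 < t" "t < 1"
  shows "isCont (form a) t"
  using one_minus_square_pos[OF assms] one_plus_square_pos[of t] assms
  by (cases a rule: letter_cases) (auto simp: form_fun intro!: continuous_intros)

lemma borel_measurable_form [measurable]: "form a \<in> borel_measurable borel"
  by (cases a rule: letter_cases) (simp_all add: form_fun)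

definition word_sgn :: "letter list \<Rightarrow> real" where
  "word_sgn w = prod_list (map form_sgn w)"

lemma word_sgn_simps [simp]: "word_sgn [] = 1" "word_sgn (a # w) = form_sgn a * word_sgn w"
  by (simp_all add: word_sgn_def)

lemma word_sgn_square [simp]: "word_sgn w * word_sgn w = 1"
proof (induction w)
  case (Cons a w)
  have "word_sgn (a # w) * word_sgn (a # w) = (form_sgn a * form_sgn a) * (word_sgn w * word_sgn w)"
    by (simp only: word_sgn_simps mult_ac)
  with Cons show ?case by simp
qed simp

section \<open>Iterated integrals of nonnegative functions\<close>

definition ikernel :: "letter \<Rightarrow> (real \<Rightarrow> ennreal) \<Rightarrow> real \<Rightarrow> ennreal" where
  "ikernel a g x = (\<integral>\<^sup>+t. indicator {0<..<x} t * ennreal \<bar>form a t\<bar> * g t \<partial>lborel)"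

text \<open>The first letter is outermost. A word can thus be opened at its front, for the
  fundamental theorem of calculus, or at its end, for the simplex, with the last letter moved into
  \<open>g\<close>.\<close>

definition iterated :: "letter list \<Rightarrow> (real \<Rightarrow> ennreal) \<Rightarrow> real \<Rightarrow> ennreal" where
  "iterated w g = foldr ikernel w g"

lemma iterated_simps [simp]:
  "iterated [] g = g" "iterated (a # w) g = ikernel a (iterated w g)"
  "iterated (w @ [a]) g = iterated w (ikernel a g)"
  by (simp_all add: iterated_def)

lemma borel_measurable_ikernel [measurable]:
  assumes [measurable]: "g \<in> borel_measurable borel"
  shows "ikernel a g \<in> borel_measurable borel"
proof -
  have "ikernel a g = (\<lambda>x. \<integral>\<^sup>+t. (if 0 < t \<and> t < x then 1 else 0) * ennreal \<bar>form a t\<bar> * g t \<partial>lborel)"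
    unfolding ikernel_def by (intro ext nn_integral_cong) (auto simp: indicator_def)
  also have "\<dots> \<in> borel_measurable borel"
    by measurable
  finally show ?thesis .
qed

lemma borel_measurable_component:
  "i < n \<Longrightarrow> (\<lambda>t. t i) \<in> borel_measurable (Pi\<^sub>M {..<n} (\<lambda>_. lborel :: real measure))"
  using measurable_component_singleton[of i "{..<n}" "\<lambda>_. lborel :: real measure"] by simp

lemma borel_measurable_indicator_simplex:
  "indicator (simplex_region n) \<in> borel_measurable (Pi\<^sub>M {..<n} (\<lambda>_. lborel :: real measure))"
proof -
  let ?M = "Pi\<^sub>M {..<n} (\<lambda>_. lborel :: real measure)"
  have "Measurable.pred ?M (\<lambda>t. (\<forall>i\<in>{..<n}. 0 < t i \<and> t i < 1) \<and> (\<forall>i\<in>{i. Suc i < n}. t (Suc i) < t i))"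
  proof (intro pred_intros_logic pred_intros_finite)
    show "finite {i. Suc i < n}" by (rule finite_subset[of _ "{..<n}"]) auto
    show "Measurable.pred ?M (\<lambda>t. 0 < t i)" "Measurable.pred ?M (\<lambda>t. t i < 1)" if "i \<in> {..<n}" for i
      using that borel_measurable_component[of i n] by (auto intro!: borel_measurable_pred_less)
    show "Measurable.pred ?M (\<lambda>t. t (Suc i) < t i)" if "i \<in> {i. Suc i < n}" for i
      using that borel_measurable_component[of i n] borel_measurable_component[of "Suc i" n]
      by (auto intro!: borel_measurable_pred_less)
  qed simp
  then have "(\<lambda>t. if (\<forall>i\<in>{..<n}. 0 < t i \<and> t i < 1) \<and> (\<forall>i\<in>{i. Suc i < n}. t (Suc i) < t i) then 1 else 0)
      \<in> borel_measurable ?M"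
    by (intro measurable_If) auto
  also have "(\<lambda>t. if (\<forall>i\<in>{..<n}. 0 < t i \<and> t i < 1) \<and> (\<forall>i\<in>{i. Suc i < n}. t (Suc i) < t i) then 1 else 0)
     = indicator (simplex_region n)"
    by (auto simp: fun_eq_iff simplex_region_def indicator_def)
  finally show ?thesis .
qed

lemma simplex_region_Suc:
  "t(n := y) \<in> simplex_region (Suc n) \<longleftrightarrow>
    t \<in> simplex_region n \<and> y \<in> {0<..<(if n = 0 then 1 else t (n - 1))}"
proof (cases n)
  case 0
  then show ?thesis by (simp add: simplex_region_def)
next
  case (Suc k)
  show ?thesis (is "?L \<longleftrightarrow> ?R")
  proof
    assume L: ?L
    then have "(t(n := y)) (Suc k) < (t(n := y)) k" unfolding simplex_region_def by (auto simp: Suc)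
    with L show ?R unfolding simplex_region_def
      by (auto simp: Suc less_Suc_eq split: if_splits)
  next
    assume R: ?R
    then have "t k < 1" by (auto simp: simplex_region_def Suc)
    with R show ?L unfolding simplex_region_def
      by (auto simp: Suc less_Suc_eq)
  qed
qed

text \<open>The extra function \<open>g\<close> of the smallest variable absorbs the last letter
  once that variable is integrated out by Tonelli. For the empty word its argument is 1, the upper
  limit of the outermost integral.\<close>

lemma nn_integral_simplex:
  assumes "g \<in> borel_measurable borel"
  shows "(\<integral>\<^sup>+t. indicator (simplex_region (length w)) t *
      (\<Prod>i<length w. ennreal \<bar>form (w ! i) (t i)\<bar>) *
      g (if length w = 0 then 1 else t (length w - 1)) \<partial>Pi\<^sub>M {..<length w} (\<lambda>_. lborel)) = iterated w g 1"
  using assms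
proof (induction w arbitrary: g rule: rev_induct)
  case Nil
  show ?case by (simp add: PiM_empty nn_integral_count_space_finite simplex_region_def)
next
  case (snoc a w)
  note [measurable] = snoc.prems
  interpret product_sigma_finite "\<lambda>_ :: nat. lborel :: real measure" ..
  define n where "n = length w"
  let ?b = "\<lambda>t :: nat \<Rightarrow> real. if n = 0 then 1 else t (n - 1)"
  let ?f = "\<lambda>t. indicator (simplex_region (Suc n)) t *
      (\<Prod>i<Suc n. ennreal \<bar>form ((w @ [a]) ! i) (t i)\<bar>) * g (t n)"
  have meas: "?f \<in> borel_measurable (Pi\<^sub>M (insert n {..<n}) (\<lambda>_. lborel))"
    unfolding lessThan_Suc[symmetric]
    by (intro borel_measurable_times_ennreal borel_measurable_prod_ennreal
      measurable_compose[OF borel_measurable_component snoc.prems]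
      measurable_compose[OF measurable_compose[OF borel_measurable_component borel_measurable_form]]
      borel_measurable_indicator_simplex) auto
  have inner: "(\<integral>\<^sup>+y. ?f (t(n := y)) \<partial>lborel) = indicator (simplex_region n) t *
      (\<Prod>i<n. ennreal \<bar>form (w ! i) (t i)\<bar>) * ikernel a g (?b t)" for t
  proof -
    have "?f (t(n := y)) = (indicator (simplex_region n) t * (\<Prod>i<n. ennreal \<bar>form (w ! i) (t i)\<bar>)) *
        (indicator {0<..<?b t} y * ennreal \<bar>form a y\<bar> * g y)" for y
    proof -
      have "(\<Prod>i<n. ennreal \<bar>form ((w @ [a]) ! i) ((t(n := y)) i)\<bar>) = (\<Prod>i<n. ennreal \<bar>form (w ! i) (t i)\<bar>)"
        by (intro prod.cong) (auto simp: nth_append n_def)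
      moreover have "indicator (simplex_region (Suc n)) (t(n := y)) =
          (indicator (simplex_region n) t * indicator {0<..<?b t} y :: ennreal)"
        using simplex_region_Suc[of t n y] by (simp add: indicator_def del: greaterThanLessThan_iff)
      ultimately show ?thesis by (simp add: prod.lessThan_Suc n_def mult_ac)
    qed
    then show ?thesis
      by (simp only: ikernel_def) (rule nn_integral_cmult, measurable)
  qed
  have "(\<integral>\<^sup>+t. ?f t \<partial>Pi\<^sub>M (insert n {..<n}) (\<lambda>_. lborel)) =
      (\<integral>\<^sup>+t. indicator (simplex_region n) t * (\<Prod>i<n. ennreal \<bar>form (w ! i) (t i)\<bar>) *
        ikernel a g (?b t) \<partial>Pi\<^sub>M {..<n} (\<lambda>_. lborel))"
    by (subst product_nn_integral_insert[OF _ _ meas]) (simp_all only: inner finite_lessThan lessThan_iff less_irrefl not_False_eq_True)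
  also have "\<dots> = iterated w (ikernel a g) 1"
    unfolding n_def by (rule snoc.IH) simp
  finally show ?case by (simp add: n_def lessThan_Suc)
qed

text \<open>The limit \<open>L\<close> covers both uses: for b < 1 it is a value of the power
  series, for b = 1 it comes from Abel's theorem. Nonnegativity is carried along because
  \<open>ennreal\<close> sends negative numbers to 0.\<close>

lemma ikernel_eq:
  assumes w: "A1_word (a # w)" and b: "0 < b" "b \<le> 1"
    and L: "(wfun (a # w) \<longlongrightarrow> L) (at_left b)"
    and g: "\<And>t. 0 < t \<Longrightarrow> t < 1 \<Longrightarrow> g t = ennreal (word_sgn w * wfun w t) \<and> 0 \<le> word_sgn w * wfun w t"
  shows "ikernel a g b = ennreal (word_sgn (a # w) * L) \<and> 0 \<le> word_sgn (a # w) * L"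
proof -
  define s where "s = word_sgn (a # w)"
  define f where "f t = s * (form a t * wfun w t)" for t
  have f_eq: "f t = \<bar>form a t\<bar> * (word_sgn w * wfun w t)" if "0 < t" "t < 1" for t
    using that by (simp add: f_def s_def abs_form)
  have f_nonneg: "0 \<le> f t" if "0 < t" "t < 1" for t
    using f_eq[OF that] g[OF that] by simp
  have tend0: "((\<lambda>t. s * wfun (a # w) t) \<longlongrightarrow> s * 0) (at_right 0)"
  proof (intro tendsto_intros)
    have "(wfun (a # w) \<longlongrightarrow> wfun (a # w) 0) (at 0)"
      using isCont_wfun[of 0 "a # w"] by (simp add: isCont_def)
    then show "(wfun (a # w) \<longlongrightarrow> 0) (at_right 0)"
      by (simp add: wfun_0 filterlim_at_split)
  qed
  have D: "((\<lambda>t. s * wfun (a # w) t) has_real_derivative f x) (at x)" and C: "isCont f x"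
    if "ereal 0 < ereal x" "ereal x < ereal b" for x
    unfolding f_def using that b w
    by (auto intro!: DERIV_cmult wfun_deriv continuous_intros isCont_form isCont_wfun)
  have AE: "AE x in lborel. ereal 0 < ereal x \<longrightarrow> ereal x < ereal b \<longrightarrow> 0 \<le> f x"
    using b f_nonneg by auto
  have lim0: "(((\<lambda>t. s * wfun (a # w) t) \<circ> real_of_ereal) \<longlongrightarrow> s * 0) (at_right (ereal 0))"
    using tend0 by (simp only: ereal_tendsto_simps)
  have limb: "(((\<lambda>t. s * wfun (a # w) t) \<circ> real_of_ereal) \<longlongrightarrow> s * L) (at_left (ereal b))"
    using tendsto_mult_left[OF L, of s] by (simp only: ereal_tendsto_simps)
  have "ereal 0 < ereal b" using b by simp
  \<comment> \<open>For a nonnegative integrand, one-sided limits of the antiderivative suffice at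
    the endpoints, where the form may be singular; integrability is part of the conclusion.\<close>
  note FTC = interval_integral_FTC_nonneg[OF this D C AE lim0 limb]
  have int: "integrable lborel (\<lambda>t. indicator {0<..<b} t * f t)"
    using FTC(1) by (simp add: set_integrable_def einterval_eq)
  have val: "integral\<^sup>L lborel (\<lambda>t. indicator {0<..<b} t * f t) = s * L"
    using FTC(2) b
    unfolding interval_lebesgue_integral_def set_lebesgue_integral_def einterval_eq by simp
  have nn: "0 \<le> indicator {0<..<b} t * f t" for t
    using f_nonneg[of t] b by (auto simp: indicator_def)
  have "ikernel a g b = (\<integral>\<^sup>+t. ennreal (indicator {0<..<b} t * f t) \<partial>lborel)"
    unfolding ikernel_def
  proof (rule nn_integral_cong)
    fix t :: real
    show "indicator {0<..<b} t * ennreal \<bar>form a t\<bar> * g t = ennreal (indicator {0<..<b} t * f t)"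
    proof (cases "t \<in> {0<..<b}")
      case True
      then have "0 < t" "t < 1" using b by auto
      with True show ?thesis using g[of t] f_eq[of t] by (simp add: ennreal_mult)
    qed simp
  qed
  also have "\<dots> = ennreal (s * L)"
    unfolding val[symmetric] by (rule nn_integral_eq_integral[OF int]) (use nn in auto)
  finally have "ikernel a g b = ennreal (s * L)" .
  moreover have "0 \<le> s * L"
    unfolding val[symmetric] by (rule integral_nonneg_AE) (use nn in auto)
  ultimately show ?thesis by (simp only: s_def)
qed

lemma iterated_eq_wfun:
  assumes "A1_word w" "0 < t" "t < 1"
  shows "iterated w (\<lambda>_. 1) t = ennreal (word_sgn w * wfun w t) \<and> 0 \<le> word_sgn w * wfun w t"
  using assms
proof (induction w arbitrary: t)
  case (Cons a w)
  have "(wfun (a # w) \<longlongrightarrow> wfun (a # w) t) (at t)"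
    using isCont_wfun[of t "a # w"] Cons.prems by (simp add: isCont_def)
  then have "(wfun (a # w) \<longlongrightarrow> wfun (a # w) t) (at_left t)"
    by (simp only: filterlim_at_split)
  moreover have "A1_word w" using Cons.prems by (simp add: A1_word_Cons)
  ultimately show ?case
    using ikernel_eq[OF Cons.prems(1,2) _ _ Cons.IH, of "wfun (a # w) t"] Cons.prems
    by (simp del: word_sgn_simps)
qed simp

text \<open>Only the outermost integration reaches 1. The inner ones stop at t < 1, where the power
  series of the tail converges absolutely.\<close>

lemma iterated_1:
  assumes "admissible w"
  shows "iterated w (\<lambda>_. 1) 1 = ennreal (word_sgn w * suminf (wcoeff w)) \<and> 0 \<le> word_sgn w * suminf (wcoeff w)"
proof (cases w)
  case Nil
  have "suminf (wcoeff []) = 1" by (subst suminf_finite[of "{0}"]) auto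
  then show ?thesis by (simp add: Nil)
next
  case (Cons a v)
  have A1: "A1_word (a # v)" using assms by (simp add: admissible_def Cons)
  have "(wfun w \<longlongrightarrow> suminf (wcoeff w)) (at_left 1)"
    unfolding wfun_def by (intro Abel_limit summable_sums summable_wcoeff assms)
  then show ?thesis
    using ikernel_eq[OF A1, of 1 "suminf (wcoeff w)" "iterated v (\<lambda>_. 1)"] iterated_eq_wfun[of v] A1
    by (simp add: Cons A1_word_Cons del: word_sgn_simps)
qed

text \<open>On the region the integrand has the constant sign \<open>word_sgn w\<close>. The
  integral of its absolute value being finite gives convergence, and multiplied by that sign it
  gives the value.\<close>

lemma
  assumes "admissible w"
  shows int_converges_admissible: "int_converges w"
    and iter_int_admissible: "iter_int w = suminf (wcoeff w)"
proof -
  define n where "n = length w"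
  let ?M = "Pi\<^sub>M {..<n} (\<lambda>_. lborel :: real measure)"
  let ?I = "indicator (simplex_region n) :: _ \<Rightarrow> real"
  define F where "F t = ?I t * (\<Prod>i<n. \<bar>form (w ! i) (t i)\<bar>)" for t
  have F: "?I t * (\<Prod>i<n. form (w ! i) (t i)) = word_sgn w * F t" for t
  proof (cases "t \<in> simplex_region n")
    case True
    have "word_sgn w = (\<Prod>i<n. form_sgn (w ! i))"
      by (simp add: word_sgn_def prod.list_conv_set_nth n_def atLeast0LessThan)
    moreover have "F t = (\<Prod>i<n. form_sgn (w ! i) * form (w ! i) (t i))"
      using True by (auto simp: F_def simplex_region_def abs_form intro!: prod.cong)
    ultimately have "F t = word_sgn w * (\<Prod>i<n. form (w ! i) (t i))"
      by (simp add: prod.distrib)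
    with True show ?thesis by (simp flip: mult.assoc)
  qed (simp add: F_def)
  have F_nonneg: "0 \<le> F t" for t by (simp add: F_def prod_nonneg)
  have [measurable]: "F \<in> borel_measurable ?M"
    unfolding F_def
    by (intro borel_measurable_times borel_measurable_prod borel_measurable_abs borel_measurable_indicator_simplex
        measurable_compose[OF borel_measurable_component borel_measurable_form]) auto
  have "ennreal (F t) = indicator (simplex_region n) t * (\<Prod>i<n. ennreal \<bar>form (w ! i) (t i)\<bar>) * 1" for t
    by (auto simp: F_def indicator_def prod_ennreal)
  then have int: "(\<integral>\<^sup>+t. ennreal (F t) \<partial>?M) = iterated w (\<lambda>_. 1) 1"
    using nn_integral_simplex[of "\<lambda>_. 1" w] by (simp add: n_def)
  have "integrable ?M F"
    using int iterated_1[OF assms] F_nonneg by (intro integrableI_nonneg) auto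
  then show "int_converges w"
    by (simp add: int_converges_def set_integrable_def F flip: n_def)
  have "integral\<^sup>L ?M F = word_sgn w * suminf (wcoeff w)"
    using int iterated_1[OF assms] F_nonneg by (subst integral_eq_nn_integral) auto
  then show "iter_int w = suminf (wcoeff w)"
    by (simp add: iter_int_def set_lebesgue_integral_def F flip: n_def mult.assoc)
qed

section \<open>From truncated sums to integrals\<close>

lemma M_map_eval: "M_map x = eval_words iter_int x"
  by (simp add: M_map_def eval_words_def)

lemma eval_wsum_tendsto:
  assumes "x \<in> A0"
  shows "(\<lambda>N. eval_words (wsum N) x) \<longlonglongrightarrow> M_map x"
  unfolding M_map_eval eval_words_def
proof (intro tendsto_sum tendsto_mult tendsto_const)
  fix w assume "w \<in> Poly_Mapping.keys x"
  then have "admissible w" using assms by (simp add: A0_def)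
  then show "(\<lambda>N. wsum N w) \<longlonglongrightarrow> iter_int w"
    using summable_LIMSEQ[OF summable_wcoeff] by (simp add: wsum_def[abs_def] iter_int_admissible)
qed

theorem proposition2p5:
  "(\<forall>w. admissible w \<longrightarrow> int_converges w) \<and>
   (\<forall>u\<in>A0. \<forall>v\<in>A0. u \<star> v \<in> A0) \<and>
   M_map (word []) = 1 \<and>
   (\<forall>u\<in>A0. \<forall>v\<in>A0. M_map (u + v) = M_map u + M_map v) \<and>
   (\<forall>c. \<forall>u\<in>A0. M_map (qscale c u) = of_rat c * M_map u) \<and>
   (\<forall>u\<in>A0. \<forall>v\<in>A0. M_map (u \<star> v) = M_map u * M_map v)"
proof (intro conjI allI ballI impI)
  fix w assume "admissible w"
  then show "int_converges w" by (rule int_converges_admissible)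
next
  fix u v assume uv: "u \<in> A0" "v \<in> A0"
  show star: "u \<star> v \<in> A0" using uv by (rule star_A0)
  show "M_map (u + v) = M_map u + M_map v" by (simp add: M_map_eval)
  have "u \<in> A1" "v \<in> A1" using uv by (auto simp: A0_def A1_def admissible_def)
  \<comment> \<open>The products of truncated sums are the truncated sums of
    \<open>u \<star> v\<close>, and these converge to its integral because
    \<open>u \<star> v\<close> lies in \<open>A0\<close> again.\<close>
  then have "(\<lambda>N. eval_words (wsum N) u * eval_words (wsum N) v) \<longlonglongrightarrow> M_map (u \<star> v)"
    using eval_wsum_tendsto[OF star] by (simp add: eval_star)
  then show "M_map (u \<star> v) = M_map u * M_map v"
    using tendsto_mult[OF eval_wsum_tendsto[OF uv(1)] eval_wsum_tendsto[OF uv(2)]]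
    by (rule LIMSEQ_unique)
next
  have "suminf (wcoeff []) = 1" by (subst suminf_finite[of "{0}"]) auto
  then show "M_map (word []) = 1"
    by (simp add: M_map_eval iter_int_admissible admissible_def A1_word_def)
next
  fix c u
  show "M_map (qscale c u) = of_rat c * M_map u" by (simp add: M_map_eval)
qed

end
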